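(* Let $A$ be a $C^*$-algebra with multiplier algebra $M(A)$. Then \[ \operatorname{rr}(A) \leq \operatorname{xrr}(A) \leq \operatorname{rr}(M(A)), \] where $\operatorname{rr}$ denotes the real rank and $\operatorname{xrr}$ the extension real rank.
   Context: For a unital $C^*$-algebra $D$, let $D_{\mathrm{sa}}$ be its set of self-adjoint elements and let $\operatorname{Lg}_n(D)_{\mathrm{sa}}$ be the set of tuples $(a_1,\ldots,a_n)\in (D_{\mathrm{sa}})^n$ such that $\sum_{k=1}^n a_k^2$ is invertible in $D$ (the zero algebra is regarded as unital, with $0=1$ invertible). The real rank $\operatorname{rr}(D)$ is the least integer $n\geq 0$ such that $\operatorname{Lg}_{n+1}(D)_{\mathrm{sa}}$ is dense in $(D_{\mathrm{sa}})^{n+1}$, and $\operatorname{rr}(D)=\infty$ if there is no such $n$. If $D$ is nonunital, $\operatorname{rr}(D):=\operatorname{rr}(\widetilde{D})$, where $\widetilde{D}$ is the minimal unitization. For a $C^*$-algebra $A$ let $M(A)$ be its multiplier algebra and $\pi_A\colon M(A)\to M(A)/A$ the quotient map. For $n\in\mathbb{N}=\{0,1,2,\ldots\}$, $A$ has property $(\Lambda_n)$ if for every $(a_0,\ldots,a_n)\in M(A)_{\mathrm{sa}}^{n+1}$ with $(\pi_A(a_0),\ldots,\pi_A(a_n))\in\operatorname{Lg}_{n+1}(M(A)/A)_{\mathrm{sa}}$ and every $\varepsilon>0$ there is $(b_0,\ldots,b_n)\in\operatorname{Lg}_{n+1}(M(A))_{\mathrm{sa}}$ with $\|a_j-b_j\|<\varepsilon$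 and $\pi_A(a_j)=\pi_A(b_j)$ for $j=0,\ldots,n$. The extension real rank $\operatorname{xrr}(A)$ is the smallest $n\in\mathbb{N}$ such that $A$ has $(\Lambda_m)$ for all $m\geq n$, and $\operatorname{xrr}(A)=\infty$ if no such $n$ exists. *)

theory Defs
  imports "HOL-Analysis.Analysis"
begin

section \<open>C*-algebras\<close>

class star =
  fixes star :: "'a \<Rightarrow> 'a"

class star_ring = ring + star +
  assumes star_add: "star (x + y) = star x + star y"
    and star_mult: "star (x * y) = star y * star x"
    and star_star [simp]: "star (star x) = x"

class scaleC =
  fixes scaleC :: "complex \<Rightarrow> 'a \<Rightarrow> 'a"  (infixr "*\<^sub>C" 75)

text \<open>Not necessarily unital complex C*-algebras. The class does not assume
  a unit, and its instances include the zero algebra.\<close>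

class cstar_algebra = real_normed_algebra + banach + star_ring + scaleC +
  assumes scaleC_add_right: "c *\<^sub>C (x + y) = c *\<^sub>C x + c *\<^sub>C y"
    and scaleC_add_left: "(c + d) *\<^sub>C x = c *\<^sub>C x + d *\<^sub>C x"
    and scaleC_scaleC: "c *\<^sub>C d *\<^sub>C x = (c * d) *\<^sub>C x"
    and scaleR_scaleC: "r *\<^sub>R x = complex_of_real r *\<^sub>C x"
    and norm_scaleC: "norm (c *\<^sub>C x) = cmod c * norm x"
    and mult_scaleC_left: "(c *\<^sub>C x) * y = c *\<^sub>C (x * y)"
    and mult_scaleC_right: "x * (c *\<^sub>C y) = c *\<^sub>C (x * y)"
    and star_scaleC: "star (c *\<^sub>C x) = cnj c *\<^sub>C star x"
    and cstar_identity: "norm (star x * x) = (norm x)\<^sup>2"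

lemma star_zero [simp]: "star (0::'a::star_ring) = 0"
  using star_add[of "0::'a" 0] by simp

lemma star_minus: "star (- x) = - star (x::'a::star_ring)"
  using star_add[of x "- x"] by (simp add: eq_neg_iff_add_eq_0 add.commute)

lemma star_diff: "star (x - y) = star x - star (y::'a::star_ring)"
  using star_add[of x "- y"] by (simp add: star_minus)

lemma scaleC_one [simp]: "1 *\<^sub>C x = (x::'a::cstar_algebra)"
  using scaleR_scaleC[of 1 x] by simp

lemma scaleC_zero_left [simp]: "0 *\<^sub>C x = (0::'a::cstar_algebra)"
  using scaleR_scaleC[of 0 x] by simp

lemma scaleC_zero_right [simp]: "c *\<^sub>C 0 = (0::'a::cstar_algebra)"
  using scaleC_add_right[of c "0::'a" 0] by simp

lemma scaleC_minus_right: "c *\<^sub>C (- x) = - (c *\<^sub>C (x::'a::cstar_algebra))"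
  using scaleC_add_right[of c x "- x"] by (simp add: eq_neg_iff_add_eq_0 add.commute)

lemma scaleC_diff_right: "c *\<^sub>C (x - y) = c *\<^sub>C x - c *\<^sub>C (y::'a::cstar_algebra)"
  using scaleC_add_right[of c x "- y"] by (simp add: scaleC_minus_right)

lemma scaleC_minus_left: "(- c) *\<^sub>C x = - (c *\<^sub>C (x::'a::cstar_algebra))"
  using scaleC_add_left[of c "- c" x] by (simp add: eq_neg_iff_add_eq_0 add.commute)

lemma scaleC_diff_left: "(c - d) *\<^sub>C x = c *\<^sub>C x - d *\<^sub>C (x::'a::cstar_algebra)"
  using scaleC_add_left[of c "- d" x] by (simp add: scaleC_minus_left)

lemma scaleC_scaleR: "c *\<^sub>C r *\<^sub>R x = r *\<^sub>R c *\<^sub>C (x::'a::cstar_algebra)"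
  by (simp add: scaleR_scaleC scaleC_scaleC mult.commute)

lemma star_scaleR: "star (r *\<^sub>R x) = r *\<^sub>R star (x::'a::cstar_algebra)"
  by (simp add: scaleR_scaleC star_scaleC)

lemma norm_star [simp]: "norm (star x) = norm (x::'a::cstar_algebra)"
proof -
  have le: "norm y \<le> norm (star y)" for y :: 'a
  proof (cases "norm y = 0")
    case False
    have "norm y * norm y \<le> norm (star y) * norm y"
      using norm_mult_ineq[of "star y" y] by (simp add: cstar_identity power2_eq_square)
    with False show ?thesis
      by (simp add: mult_le_cancel_right)
  qed auto
  from le[of x] le[of "star x"] show ?thesis by simp
qed

lemma cstar_identity': "norm (x * star x) = (norm (x::'a::cstar_algebra))\<^sup>2"
  using cstar_identity[of "star x"] by simp


section \<open>Real rank of unital C*-algebras\<close>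

text \<open>Units are expressed as a property of elements, so that the notions below make
  sense for algebras without a distinguished constant \<open>1\<close>. In the zero ring, \<open>0\<close> is
  the unit and is invertible.\<close>

definition is_unit_elem :: "'a::ring \<Rightarrow> bool" where
  "is_unit_elem e \<longleftrightarrow> (\<forall>x. e * x = x \<and> x * e = x)"

definition unital :: "'a::ring itself \<Rightarrow> bool" where
  "unital _ \<longleftrightarrow> (\<exists>e::'a. is_unit_elem e)"

definition invertible_elem :: "'a::ring \<Rightarrow> bool" where
  "invertible_elem x \<longleftrightarrow> (\<exists>y. is_unit_elem (x * y) \<and> is_unit_elem (y * x))"

definition self_adjoint :: "'a::star_ring set" where
  "self_adjoint = {a. star a = a}"

text \<open>An \<open>n\<close>-tuple is an extensional function on \<open>{..<n}\<close>. The definition only involves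
  the *-ring structure.\<close>

definition Lg :: "nat \<Rightarrow> (nat \<Rightarrow> 'a::star_ring) set" where
  "Lg n = {a \<in> {..<n} \<rightarrow>\<^sub>E self_adjoint. invertible_elem (\<Sum>k<n. a k * a k)}"

definition sa_tuples :: "nat \<Rightarrow> (nat \<Rightarrow> 'a::cstar_algebra) topology" where
  "sa_tuples n = product_topology (\<lambda>_. top_of_set self_adjoint) {..<n}"

definition Lg_dense :: "'a::cstar_algebra itself \<Rightarrow> nat \<Rightarrow> bool" where
  "Lg_dense _ n \<longleftrightarrow> sa_tuples n closure_of (Lg n :: (nat \<Rightarrow> 'a) set) = topspace (sa_tuples n)"

text \<open>The infimum of the empty set is \<open>\<infinity>\<close>. This is the real rank only for unital algebras;
  see \<open>real_rank\<close> below for the general case.\<close>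

definition real_rank_unital :: "'a::cstar_algebra itself \<Rightarrow> enat" where
  "real_rank_unital T = Inf {enat n |n. Lg_dense T (Suc n)}"

lemma topspace_sa_tuples: "topspace (sa_tuples n) = {..<n} \<rightarrow>\<^sub>E self_adjoint"
  by (simp add: sa_tuples_def)

lemma Lg_dense_iff:
  "Lg_dense TYPE('a::cstar_algebra) n \<longleftrightarrow>
    (\<forall>a \<in> {..<n} \<rightarrow>\<^sub>E (self_adjoint :: 'a set). \<forall>\<epsilon>>0. \<exists>b \<in> Lg n. \<forall>k<n. norm (a k - b k) < \<epsilon>)"
proof
  assume L: "Lg_dense TYPE('a) n"
  show "\<forall>a \<in> {..<n} \<rightarrow>\<^sub>E (self_adjoint :: 'a set). \<forall>\<epsilon>>0. \<exists>b \<in> Lg n. \<forall>k<n. norm (a k - b k) < \<epsilon>"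
  proof (intro ballI allI impI)
    fix a :: "nat \<Rightarrow> 'a" and \<epsilon> :: real
    assume a: "a \<in> {..<n} \<rightarrow>\<^sub>E self_adjoint" and \<epsilon>: "\<epsilon> > 0"
    define V where "V = (\<Pi>\<^sub>E k\<in>{..<n}. self_adjoint \<inter> ball (a k) \<epsilon>)"
    have "openin (sa_tuples n) V"
      unfolding sa_tuples_def V_def
      by (subst openin_PiE_gen) (auto simp: openin_open)
    moreover have "a \<in> V" using a \<epsilon> by (auto simp: V_def PiE_iff)
    moreover have "a \<in> sa_tuples n closure_of Lg n"
      using L a by (simp add: Lg_dense_def topspace_sa_tuples)
    ultimately obtain b where "b \<in> Lg n" "b \<in> V"
      by (meson in_closure_of)
    then show "\<exists>b \<in> Lg n. \<forall>k<n. norm (a k - b k) < \<epsilon>"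
      by (auto simp: V_def PiE_iff dist_norm intro!: bexI[of _ b])
  qed
next
  assume R: "\<forall>a \<in> {..<n} \<rightarrow>\<^sub>E (self_adjoint :: 'a set). \<forall>\<epsilon>>0. \<exists>b \<in> Lg n. \<forall>k<n. norm (a k - b k) < \<epsilon>"
  have "a \<in> sa_tuples n closure_of Lg n" if a: "a \<in> {..<n} \<rightarrow>\<^sub>E (self_adjoint :: 'a set)" for a
    unfolding in_closure_of
  proof (intro conjI allI impI)
    show "a \<in> topspace (sa_tuples n)" using a by (simp add: topspace_sa_tuples)
    fix T assume "a \<in> T \<and> openin (sa_tuples n) T"
    then have T: "a \<in> T" "openin (sa_tuples n) T" by auto
    obtain U where U: "\<And>k. k < n \<Longrightarrow> openin (top_of_set self_adjoint) (U k)"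
        "a \<in> Pi\<^sub>E {..<n} U" "Pi\<^sub>E {..<n} U \<subseteq> T"
    proof -
      from T obtain U where "\<forall>k\<in>{..<n}. openin (top_of_set self_adjoint) (U k)"
          "a \<in> Pi\<^sub>E {..<n} U" "Pi\<^sub>E {..<n} U \<subseteq> T"
        unfolding sa_tuples_def openin_product_topology_alt by blast
      then show thesis using that by blast
    qed
    have "\<exists>e>0. \<forall>x\<in>self_adjoint. dist x (a k) < e \<longrightarrow> x \<in> U k" if "k < n" for k
      using U(1)[OF that] U(2) that unfolding openin_euclidean_subtopology_iff
      by (auto simp: PiE_iff)
    then obtain e where e: "\<And>k. k < n \<Longrightarrow> e k > 0"
        "\<And>k x. k < n \<Longrightarrow> x \<in> self_adjoint \<Longrightarrow> dist x (a k) < e k \<Longrightarrow> x \<in> U k"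
      by metis
    define \<epsilon> where "\<epsilon> = Min (insert (1::real) (e ` {..<n}))"
    have "\<epsilon> > 0" unfolding \<epsilon>_def using e(1) by auto
    then obtain b where b: "b \<in> Lg n" "\<And>k. k < n \<Longrightarrow> norm (a k - b k) < \<epsilon>"
      using R a by blast
    have "b k \<in> U k" if "k < n" for k
    proof (rule e(2)[OF that])
      show "b k \<in> self_adjoint" using b(1) that by (auto simp: Lg_def PiE_iff)
      have "\<epsilon> \<le> e k" unfolding \<epsilon>_def using that by auto
      then show "dist (b k) (a k) < e k" using b(2)[OF that] by (simp add: dist_norm norm_minus_commute)
    qed
    then have "b \<in> Pi\<^sub>E {..<n} U" using b(1) by (auto simp: Lg_def PiE_iff)
    then have "b \<in> T" using U(3) by blast
    then show "\<exists>y. y \<in> Lg n \<and> y \<in> T" using b(1) by blast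
  qed
  then show "Lg_dense TYPE('a) n"
    unfolding Lg_dense_def topspace_sa_tuples
    using closure_of_subset_topspace[of "sa_tuples n" "Lg n :: (nat \<Rightarrow> 'a) set"]
    by (auto simp: topspace_sa_tuples)
qed


section \<open>The multiplier algebra\<close>

text \<open>\<open>M(A)\<close> is the C*-algebra of double centralizers \<open>(L, R)\<close> of \<open>A\<close>, with product
  \<open>(L\<^sub>1, R\<^sub>1)(L\<^sub>2, R\<^sub>2) = (L\<^sub>1 L\<^sub>2, R\<^sub>2 R\<^sub>1)\<close> and norm \<open>\<parallel>L\<parallel> = \<parallel>R\<parallel>\<close>. Since \<open>'a \<Rightarrow>\<^sub>L 'a\<close> only
  provides real linearity, complex homogeneity is required explicitly.\<close>

definition double_centralizers ::
    "(('a::cstar_algebra \<Rightarrow>\<^sub>L 'a) \<times> ('a \<Rightarrow>\<^sub>L 'a)) set" where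
  "double_centralizers = {(L :: 'a \<Rightarrow>\<^sub>L 'a, R :: 'a \<Rightarrow>\<^sub>L 'a).
      (\<forall>c a. L (c *\<^sub>C a) = c *\<^sub>C L a) \<and> (\<forall>c a. R (c *\<^sub>C a) = c *\<^sub>C R a) \<and>
      (\<forall>a b. L (a * b) = L a * b) \<and> (\<forall>a b. R (a * b) = a * R b) \<and>
      (\<forall>a b. R a * b = a * L b)}"

lift_definition blinfun_scaleC :: "complex \<Rightarrow> ('a::cstar_algebra \<Rightarrow>\<^sub>L 'a) \<Rightarrow> ('a \<Rightarrow>\<^sub>L 'a)"
  is "\<lambda>c f a. c *\<^sub>C f a"
proof -
  fix c and f :: "'a \<Rightarrow> 'a" assume "bounded_linear f"
  then interpret f: bounded_linear f .
  obtain K where K: "\<And>x. norm (f x) \<le> norm x * K" using f.bounded by blast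
  show "bounded_linear (\<lambda>a. c *\<^sub>C f a)"
  proof (rule bounded_linear_intro[where K = "cmod c * K"])
    fix x show "norm (c *\<^sub>C f x) \<le> norm x * (cmod c * K)"
      using mult_left_mono[OF K[of x] norm_ge_zero[of c]] by (simp add: norm_scaleC ac_simps)
  qed (simp_all add: f.add f.scaleR scaleC_add_right scaleC_scaleR)
qed

lift_definition blinfun_star :: "('a::cstar_algebra \<Rightarrow>\<^sub>L 'a) \<Rightarrow> ('a \<Rightarrow>\<^sub>L 'a)"
  is "\<lambda>f a. star (f (star a))"
proof -
  fix f :: "'a \<Rightarrow> 'a" assume "bounded_linear f"
  then interpret f: bounded_linear f .
  obtain K where K: "\<And>x. norm (f x) \<le> norm x * K" using f.bounded by blast
  show "bounded_linear (\<lambda>a. star (f (star a)))"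
    by (rule bounded_linear_intro[where K = K])
      (use K[of "star x" for x] in \<open>simp_all add: f.add f.scaleR star_add star_scaleR\<close>)
qed

lemmas blinfun_star_apply [simp] = blinfun_star.rep_eq
lemmas blinfun_scaleC_apply [simp] = blinfun_scaleC.rep_eq

lemma norm_blinfun_star [simp]: "norm (blinfun_star f) = norm f"
proof -
  have le: "norm (blinfun_star g) \<le> norm g" for g :: "'a \<Rightarrow>\<^sub>L 'a"
    by (rule norm_blinfun_bound) (use norm_blinfun[of g "star x" for x] in simp_all)
  have "blinfun_star (blinfun_star f) = f" by (rule blinfun_eqI) simp
  with le[of f] le[of "blinfun_star f"] show ?thesis by simp
qed

lifting_forget blinfun.lifting

typedef (overloaded) 'a multiplier = "double_centralizers :: (('a::cstar_algebra \<Rightarrow>\<^sub>L 'a) \<times> ('a \<Rightarrow>\<^sub>L 'a)) set"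
  by (rule exI[of _ 0]) (auto simp: double_centralizers_def zero_prod_def)

setup_lifting type_definition_multiplier

lift_definition left_mult :: "'a::cstar_algebra multiplier \<Rightarrow> ('a \<Rightarrow>\<^sub>L 'a)" is fst .
lift_definition right_mult :: "'a::cstar_algebra multiplier \<Rightarrow> ('a \<Rightarrow>\<^sub>L 'a)" is snd .

lemma multiplier_eqI:
  assumes "\<And>a. left_mult x a = left_mult y a" "\<And>a. right_mult x a = right_mult y a"
  shows "x = y"
  using assms by transfer (auto intro!: prod_eqI blinfun_eqI)

lemma
  fixes x :: "'a::cstar_algebra multiplier"
  shows left_mult_scaleC: "left_mult x (c *\<^sub>C a) = c *\<^sub>C left_mult x a"
    and right_mult_scaleC: "right_mult x (c *\<^sub>C a) = c *\<^sub>C right_mult x a"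
    and left_mult_mult: "left_mult x (a * b) = left_mult x a * b"
    and right_mult_mult: "right_mult x (a * b) = a * right_mult x b"
    and right_mult_left_mult: "right_mult x a * b = a * left_mult x b"
  by (transfer; auto simp: double_centralizers_def)+

lemma norm_left_mult_eq_norm_right_mult:
  fixes x :: "'a::cstar_algebra multiplier"
  shows "norm (left_mult x) = norm (right_mult x)"
proof (rule antisym)
  show "norm (left_mult x) \<le> norm (right_mult x)"
  proof (rule norm_blinfun_bound)
    fix b
    let ?y = "left_mult x b"
    have "norm ?y * norm ?y = norm (right_mult x (star ?y) * b)"
      using cstar_identity[of ?y] by (simp add: right_mult_left_mult power2_eq_square)
    also have "\<dots> \<le> (norm (right_mult x) * norm ?y) * norm b"
      by (rule order_trans[OF norm_mult_ineq])
        (use norm_blinfun[of "right_mult x" "star ?y"] in \<open>auto intro!: mult_right_mono\<close>)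
    finally have "norm ?y * norm ?y \<le> (norm (right_mult x) * norm b) * norm ?y" by (simp add: ac_simps)
    then show "norm ?y \<le> norm (right_mult x) * norm b"
      by (cases "norm ?y = 0") (auto dest: mult_right_le_imp_le)
  qed simp
  show "norm (right_mult x) \<le> norm (left_mult x)"
  proof (rule norm_blinfun_bound)
    fix b
    let ?y = "right_mult x b"
    have "norm ?y * norm ?y = norm (b * left_mult x (star ?y))"
      using cstar_identity'[of ?y] by (simp add: right_mult_left_mult power2_eq_square)
    also have "\<dots> \<le> norm b * (norm (left_mult x) * norm ?y)"
      by (rule order_trans[OF norm_mult_ineq])
        (use norm_blinfun[of "left_mult x" "star ?y"] in \<open>auto intro!: mult_left_mono\<close>)
    finally have "norm ?y * norm ?y \<le> (norm (left_mult x) * norm b) * norm ?y" by (simp add: ac_simps)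
    then show "norm ?y \<le> norm (left_mult x) * norm b"
      by (cases "norm ?y = 0") (auto dest: mult_right_le_imp_le)
  qed simp
qed

instantiation multiplier :: (cstar_algebra) real_normed_vector
begin

lift_definition zero_multiplier :: "'a multiplier" is 0
  by (auto simp: double_centralizers_def zero_prod_def)
lift_definition plus_multiplier :: "'a multiplier \<Rightarrow> 'a multiplier \<Rightarrow> 'a multiplier" is "(+)"
  by (auto simp: double_centralizers_def plus_prod_def blinfun.add_left scaleC_add_right algebra_simps)
lift_definition uminus_multiplier :: "'a multiplier \<Rightarrow> 'a multiplier" is uminus
  by (auto simp: double_centralizers_def uminus_prod_def blinfun.minus_left scaleC_minus_right)
lift_definition minus_multiplier :: "'a multiplier \<Rightarrow> 'a multiplier \<Rightarrow> 'a multiplier" is "(-)"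
  by (auto simp: double_centralizers_def minus_prod_def blinfun.diff_left scaleC_diff_right algebra_simps)
lift_definition scaleR_multiplier :: "real \<Rightarrow> 'a multiplier \<Rightarrow> 'a multiplier" is "(*\<^sub>R)"
  by (auto simp: double_centralizers_def scaleR_prod_def blinfun.scaleR_left scaleC_scaleR)

definition norm_multiplier :: "'a multiplier \<Rightarrow> real" where
  "norm_multiplier x = norm (left_mult x)"
definition dist_multiplier :: "'a multiplier \<Rightarrow> 'a multiplier \<Rightarrow> real" where
  "dist_multiplier x y = norm (x - y)"
definition sgn_multiplier :: "'a multiplier \<Rightarrow> 'a multiplier" where
  "sgn_multiplier x = inverse (norm x) *\<^sub>R x"
definition uniformity_multiplier :: "('a multiplier \<times> 'a multiplier) filter" where
  "uniformity_multiplier = (INF e\<in>{0 <..}. principal {(x, y). dist x y < e})"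
definition open_multiplier :: "'a multiplier set \<Rightarrow> bool" where
  "open_multiplier S = (\<forall>x\<in>S. \<forall>\<^sub>F (x', y) in uniformity. x' = x \<longrightarrow> y \<in> S)"

lemma left_mult_linear [simp]:
  "left_mult (0 :: 'a multiplier) = 0"
  "left_mult (x + y) = left_mult x + left_mult y"
  "left_mult (- x) = - left_mult x"
  "left_mult (x - y) = left_mult x - left_mult y"
  "left_mult (r *\<^sub>R x) = r *\<^sub>R left_mult x"
  by (transfer; simp)+

lemma right_mult_linear [simp]:
  "right_mult (0 :: 'a multiplier) = 0"
  "right_mult (x + y) = right_mult x + right_mult y"
  "right_mult (- x) = - right_mult x"
  "right_mult (x - y) = right_mult x - right_mult y"
  "right_mult (r *\<^sub>R x) = r *\<^sub>R right_mult x"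
  by (transfer; simp)+

instance
proof
  fix x y z :: "'a multiplier" and r s :: real
  show "x + y + z = x + (y + z)" "x + y = y + x" "0 + x = x" "- x + x = 0" "x - y = x + - y"
    by (transfer; simp)+
  show "r *\<^sub>R (x + y) = r *\<^sub>R x + r *\<^sub>R y" "(r + s) *\<^sub>R x = r *\<^sub>R x + s *\<^sub>R x"
    "r *\<^sub>R s *\<^sub>R x = (r * s) *\<^sub>R x" "1 *\<^sub>R x = x"
    by (transfer; simp add: algebra_simps)+
  show "dist x y = norm (x - y)" by (fact dist_multiplier_def)
  show "sgn x = inverse (norm x) *\<^sub>R x" by (fact sgn_multiplier_def)
  show "uniformity = (INF e\<in>{0 <..}. principal {(x :: 'a multiplier, y). dist x y < e})"
    by (fact uniformity_multiplier_def)
  show "open U = (\<forall>x\<in>U. \<forall>\<^sub>F (x', y) in uniformity. x' = x \<longrightarrow> y \<in> U)" for U :: "'a multiplier set"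
    by (fact open_multiplier_def)
  show "norm x = 0 \<longleftrightarrow> x = 0"
  proof
    assume "norm x = 0"
    then have "left_mult x = 0" "right_mult x = 0"
      using norm_left_mult_eq_norm_right_mult[of x] by (auto simp: norm_multiplier_def)
    then show "x = 0" by (auto intro: multiplier_eqI)
  qed (simp add: norm_multiplier_def)
  show "norm (x + y) \<le> norm x + norm y" by (simp add: norm_multiplier_def norm_triangle_ineq)
  show "norm (r *\<^sub>R x) = \<bar>r\<bar> * norm x" by (simp add: norm_multiplier_def)
qed

end

lemma norm_multiplier_right: "norm x = norm (right_mult x)"
  by (simp add: norm_multiplier_def norm_left_mult_eq_norm_right_mult)

instance multiplier :: (cstar_algebra) banach
proof
  fix X :: "nat \<Rightarrow> 'a multiplier" assume X: "Cauchy X"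
  have "Cauchy (\<lambda>n. left_mult (X n))" "Cauchy (\<lambda>n. right_mult (X n))"
    using X unfolding Cauchy_def dist_norm left_mult_linear(4)[symmetric]
      right_mult_linear(4)[symmetric] norm_left_mult_eq_norm_right_mult[symmetric]
    by (simp_all only: norm_multiplier_def)
  then obtain L R where L: "(\<lambda>n. left_mult (X n)) \<longlonglongrightarrow> L" and R: "(\<lambda>n. right_mult (X n)) \<longlonglongrightarrow> R"
    by (auto simp: convergent_def dest!: Cauchy_convergent)
  have La: "(\<lambda>n. left_mult (X n) a) \<longlonglongrightarrow> L a" and Ra: "(\<lambda>n. right_mult (X n) a) \<longlonglongrightarrow> R a" for a
    by (intro tendsto_intros L R)+
  have C: "(\<lambda>n. c *\<^sub>C f n) \<longlonglongrightarrow> c *\<^sub>C l" if "f \<longlonglongrightarrow> l" for c and f :: "nat \<Rightarrow> 'a" and l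
  proof -
    have "bounded_linear (\<lambda>x. c *\<^sub>C (x::'a))"
      by (rule bounded_linear_intro[where K = "cmod c"])
        (simp_all add: scaleC_add_right scaleC_scaleR norm_scaleC)
    then show ?thesis using that by (rule bounded_linear.tendsto)
  qed
  have "(L, R) \<in> double_centralizers"
    unfolding double_centralizers_def
  proof (safe)
    fix c a b
    show "L (c *\<^sub>C a) = c *\<^sub>C L a"
      using La[of "c *\<^sub>C a"] C[OF La, of c a] by (auto simp: left_mult_scaleC dest: LIMSEQ_unique)
    show "R (c *\<^sub>C a) = c *\<^sub>C R a"
      using Ra[of "c *\<^sub>C a"] C[OF Ra, of c a] by (auto simp: right_mult_scaleC dest: LIMSEQ_unique)
    show "L (a * b) = L a * b"
      using La[of "a * b"] tendsto_mult[OF La[of a] tendsto_const[of b]]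
      by (auto simp: left_mult_mult dest: LIMSEQ_unique)
    show "R (a * b) = a * R b"
      using Ra[of "a * b"] tendsto_mult[OF tendsto_const[of a] Ra[of b]]
      by (auto simp: right_mult_mult dest: LIMSEQ_unique)
    show "R a * b = a * L b"
      using tendsto_mult[OF Ra[of a] tendsto_const[of b]] tendsto_mult[OF tendsto_const[of a] La[of b]]
      by (auto simp: right_mult_left_mult dest: LIMSEQ_unique)
  qed
  then have "left_mult (Abs_multiplier (L, R)) = L"
    by (simp add: left_mult.rep_eq Abs_multiplier_inverse)
  with L have "X \<longlonglongrightarrow> Abs_multiplier (L, R)"
    by (simp add: LIMSEQ_iff norm_multiplier_def)
  then show "convergent X" by (auto simp: convergent_def)
qed

instantiation multiplier :: (cstar_algebra) "{cstar_algebra, monoid_mult}"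
begin

lift_definition one_multiplier :: "'a multiplier" is "(id_blinfun, id_blinfun)"
  by (auto simp: double_centralizers_def)
lift_definition times_multiplier :: "'a multiplier \<Rightarrow> 'a multiplier \<Rightarrow> 'a multiplier"
  is "\<lambda>(L1, R1) (L2, R2). (L1 o\<^sub>L L2, R2 o\<^sub>L R1)"
  by (auto simp: double_centralizers_def)
lift_definition scaleC_multiplier :: "complex \<Rightarrow> 'a multiplier \<Rightarrow> 'a multiplier"
  is "\<lambda>c (L, R). (blinfun_scaleC c L, blinfun_scaleC c R)"
  by (auto simp: double_centralizers_def scaleC_scaleC mult_scaleC_left mult_scaleC_right mult.commute)
lift_definition star_multiplier :: "'a multiplier \<Rightarrow> 'a multiplier"
  is "\<lambda>(L, R). (blinfun_star R, blinfun_star L)"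
proof -
  fix p :: "('a \<Rightarrow>\<^sub>L 'a) \<times> ('a \<Rightarrow>\<^sub>L 'a)" assume p: "p \<in> double_centralizers"
  obtain L R where [simp]: "p = (L, R)" by (cases p)
  have *: "L (c *\<^sub>C a) = c *\<^sub>C L a" "R (c *\<^sub>C a) = c *\<^sub>C R a" "L (a * b) = L a * b"
    "R (a * b) = a * R b" "R a * b = a * L b" for c a b
    using p by (auto simp: double_centralizers_def)
  have **: "star (L (star a)) * b = a * star (R (star b))" for a b
    using arg_cong[OF *(5)[of "star b" "star a"], of star] by (simp add: star_mult)
  show "(case p of (L, R) \<Rightarrow> (blinfun_star R, blinfun_star L)) \<in> double_centralizers"
    using ** by (simp add: double_centralizers_def star_scaleC star_mult *(1-4))
qed

lemma left_mult_simps [simp]: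
  "left_mult (1 :: 'a multiplier) = id_blinfun"
  "left_mult (x * y) = left_mult x o\<^sub>L left_mult y"
  "left_mult (c *\<^sub>C x) = blinfun_scaleC c (left_mult x)"
  "left_mult (star x) = blinfun_star (right_mult x)"
  by (transfer; auto)+

lemma right_mult_simps [simp]:
  "right_mult (1 :: 'a multiplier) = id_blinfun"
  "right_mult (x * y) = right_mult y o\<^sub>L right_mult x"
  "right_mult (c *\<^sub>C x) = blinfun_scaleC c (right_mult x)"
  "right_mult (star x) = blinfun_star (left_mult x)"
  by (transfer; auto)+

lemmas multiplier_simps =
  blinfun.bilinear_simps left_mult_scaleC right_mult_scaleC left_mult_mult right_mult_mult

instance
proof
  fix x y z :: "'a multiplier" and r :: real and c d :: complex
  show "x * y * z = x * (y * z)" "(x + y) * z = x * z + y * z" "x * (y + z) = x * y + x * z"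
    "1 * x = x" "x * 1 = x"
    by (rule multiplier_eqI; simp add: multiplier_simps)+
  show "r *\<^sub>R x * y = r *\<^sub>R (x * y)" "x * r *\<^sub>R y = r *\<^sub>R (x * y)"
    by (rule multiplier_eqI; simp add: multiplier_simps)+
  show "norm (x * y) \<le> norm x * norm y"
    by (simp add: norm_multiplier_def norm_blinfun_compose)
  show "star (x + y) = star x + star y" "star (x * y) = star y * star x" "star (star x) = x"
    by (rule multiplier_eqI; simp add: multiplier_simps star_add)+
  show "c *\<^sub>C (x + y) = c *\<^sub>C x + c *\<^sub>C y" "(c + d) *\<^sub>C x = c *\<^sub>C x + d *\<^sub>C x"
    "c *\<^sub>C d *\<^sub>C x = (c * d) *\<^sub>C x" "r *\<^sub>R x = complex_of_real r *\<^sub>C x"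
    by (rule multiplier_eqI; simp add: multiplier_simps scaleC_add_right scaleC_add_left
        scaleC_scaleC scaleR_scaleC)+
  show "(c *\<^sub>C x) * y = c *\<^sub>C (x * y)" "x * (c *\<^sub>C y) = c *\<^sub>C (x * y)"
    by (rule multiplier_eqI; simp add: multiplier_simps)+
  show "star (c *\<^sub>C x) = cnj c *\<^sub>C star x"
    by (rule multiplier_eqI; simp add: multiplier_simps star_scaleC)
  show "norm (c *\<^sub>C x) = cmod c * norm x"
  proof -
    have le: "norm (e *\<^sub>C u) \<le> cmod e * norm u" for e and u :: "'a multiplier"
      unfolding norm_multiplier_def
      by (rule norm_blinfun_bound)
        (auto simp: norm_scaleC norm_blinfun mult.assoc intro!: mult_left_mono)
    show ?thesis
    proof (cases "c = 0")
      case True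
      then show ?thesis using le[of c x] by simp
    next
      case False
      have "inverse c *\<^sub>C c *\<^sub>C x = x"
        by (rule multiplier_eqI; simp add: scaleC_scaleC False)
      then have "norm x \<le> inverse (cmod c) * norm (c *\<^sub>C x)"
        using le[of "inverse c" "c *\<^sub>C x"] by (simp add: norm_inverse)
      then show ?thesis using le[of c x] False by (simp add: field_simps)
    qed
  qed
  show "norm (star x * x) = (norm x)\<^sup>2"
  proof (rule antisym)
    have ns: "norm (star x) = norm x"
      by (simp add: norm_multiplier_def norm_left_mult_eq_norm_right_mult)
    show "norm (star x * x) \<le> (norm x)\<^sup>2"
      using norm_blinfun_compose[of "left_mult (star x)" "left_mult x"] ns
      by (simp add: norm_multiplier_def power2_eq_square)
    have "norm (left_mult x) \<le> sqrt (norm (star x * x))"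
    proof (rule norm_blinfun_bound)
      fix b
      have "(norm (left_mult x b))\<^sup>2 = norm (star (left_mult x b) * left_mult x b)"
        by (simp add: cstar_identity)
      also have "star (left_mult x b) * left_mult x b = right_mult (star x * x) (star b) * b"
        by (simp add: right_mult_left_mult)
      also have "norm \<dots> \<le> norm (star x * x) * norm (star b) * norm b"
        unfolding norm_multiplier_right[of "star x * x"]
        by (rule order_trans[OF norm_mult_ineq mult_right_mono[OF norm_blinfun]]) simp
      also have "\<dots> = (sqrt (norm (star x * x)) * norm b)\<^sup>2"
        by (simp add: power_mult_distrib power2_eq_square)
      finally show "norm (left_mult x b) \<le> sqrt (norm (star x * x)) * norm b"
        by (rule power2_le_imp_le) simp
    qed simp
    from power_mono[OF this norm_ge_zero, of 2]
    show "(norm x)\<^sup>2 \<le> norm (star x * x)" by (simp add: norm_multiplier_def)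
  qed
qed

end

text \<open>The canonical embedding of \<open>A\<close> into \<open>M(A)\<close>.\<close>

lift_definition to_multiplier :: "'a::cstar_algebra \<Rightarrow> 'a multiplier"
  is "\<lambda>a. (blinfun_mult_right a, blinfun_mult_left a)"
  by (auto simp: double_centralizers_def blinfun_mult_right.rep_eq mult_scaleC_left
      mult_scaleC_right mult.assoc)

lemma to_multiplier_apply [simp]: "left_mult (to_multiplier a) b = a * b" "right_mult (to_multiplier a) b = b * a"
  by (transfer; simp add: blinfun_mult_right.rep_eq)+

lemma to_multiplier_simps:
  "to_multiplier 0 = 0" "to_multiplier (a + b) = to_multiplier a + to_multiplier b" "to_multiplier (- a) = - to_multiplier a"
  "to_multiplier (a - b) = to_multiplier a - to_multiplier b" "to_multiplier (a * b) = to_multiplier a * to_multiplier b"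
  "to_multiplier (c *\<^sub>C a) = c *\<^sub>C to_multiplier a" "to_multiplier (star a) = star (to_multiplier a)"
  by (rule multiplier_eqI; simp add: multiplier_simps algebra_simps mult_scaleC_left
      mult_scaleC_right star_mult)+

lemma to_multiplier_ideal:
  "x * to_multiplier a = to_multiplier (left_mult x a)" "to_multiplier a * x = to_multiplier (right_mult x a)"
  by (rule multiplier_eqI; simp add: left_mult_mult right_mult_mult right_mult_left_mult)+

lemma norm_to_multiplier [simp]: "norm (to_multiplier a) = norm a"
proof (rule antisym)
  show "norm (to_multiplier a) \<le> norm a"
    unfolding norm_multiplier_def by (rule norm_blinfun_bound) (simp_all add: norm_mult_ineq)
  have "(norm a)\<^sup>2 \<le> norm (to_multiplier a) * norm a"
    using norm_blinfun[of "left_mult (to_multiplier a)" "star a"]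
    by (simp add: cstar_identity' norm_multiplier_def)
  then show "norm a \<le> norm (to_multiplier a)"
    by (cases "norm a = 0") (auto simp: power2_eq_square)
qed


section \<open>The quotient of the multiplier algebra by the algebra\<close>

text \<open>Only the *-ring structure of \<open>M(A)/A\<close> is introduced, as \<open>Lg\<close> does not depend on the
  quotient norm.\<close>

lifting_forget multiplier.lifting

definition corona_rel :: "'a::cstar_algebra multiplier \<Rightarrow> 'a multiplier \<Rightarrow> bool" where
  "corona_rel x y \<longleftrightarrow> x - y \<in> range to_multiplier"

lemma equivp_corona_rel: "equivp (corona_rel :: 'a::cstar_algebra multiplier \<Rightarrow> _)"
proof (rule equivpI)
  show "reflp (corona_rel :: 'a multiplier \<Rightarrow> _)"
    by (rule reflpI) (simp add: corona_rel_def flip: to_multiplier_simps(1))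
  show "symp (corona_rel :: 'a multiplier \<Rightarrow> _)"
  proof (rule sympI)
    fix x y :: "'a multiplier" assume "corona_rel x y"
    then obtain a where "x - y = to_multiplier a" by (auto simp: corona_rel_def)
    moreover have "y - x = - (x - y)" by simp
    ultimately have "y - x = to_multiplier (- a)" by (simp only: to_multiplier_simps(3))
    then show "corona_rel y x" by (simp add: corona_rel_def)
  qed
  show "transp (corona_rel :: 'a multiplier \<Rightarrow> _)"
  proof (rule transpI)
    fix x y z :: "'a multiplier" assume "corona_rel x y" "corona_rel y z"
    then obtain a b where "x - y = to_multiplier a" "y - z = to_multiplier b" by (auto simp: corona_rel_def)
    then have "to_multiplier (a + b) = (x - y) + (y - z)" by (simp add: to_multiplier_simps(2))
    then have "x - z = to_multiplier (a + b)" by simp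
    then show "corona_rel x z" by (simp add: corona_rel_def)
  qed
qed

quotient_type (overloaded) 'a corona = "'a::cstar_algebra multiplier" / corona_rel
  by (rule equivp_corona_rel)

lift_definition corona_proj :: "'a::cstar_algebra multiplier \<Rightarrow> 'a corona" is "\<lambda>x. x" .

instantiation corona :: (cstar_algebra) star_ring
begin

lift_definition zero_corona :: "'a corona" is 0 .
lift_definition plus_corona :: "'a corona \<Rightarrow> 'a corona \<Rightarrow> 'a corona" is "(+)"
proof -
  fix x x' y y' :: "'a multiplier"
  assume "corona_rel x x'" "corona_rel y y'"
  then obtain a b where "x - x' = to_multiplier a" "y - y' = to_multiplier b" by (auto simp: corona_rel_def)
  moreover have "(x + y) - (x' + y') = (x - x') + (y - y')" by simp
  ultimately have "(x + y) - (x' + y') = to_multiplier (a + b)" by (simp only: to_multiplier_simps(2))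
  then show "corona_rel (x + y) (x' + y')" by (simp add: corona_rel_def)
qed
lift_definition uminus_corona :: "'a corona \<Rightarrow> 'a corona" is uminus
proof -
  fix x x' :: "'a multiplier" assume "corona_rel x x'"
  then obtain a where "x - x' = to_multiplier a" by (auto simp: corona_rel_def)
  moreover have "- x - - x' = - (x - x')" by simp
  ultimately have "- x - - x' = to_multiplier (- a)" by (simp only: to_multiplier_simps(3))
  then show "corona_rel (- x) (- x')" by (simp add: corona_rel_def)
qed
lift_definition minus_corona :: "'a corona \<Rightarrow> 'a corona \<Rightarrow> 'a corona" is "(-)"
proof -
  fix x x' y y' :: "'a multiplier"
  assume "corona_rel x x'" "corona_rel y y'"
  then obtain a b where "x - x' = to_multiplier a" "y - y' = to_multiplier b" by (auto simp: corona_rel_def)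
  moreover have "(x - y) - (x' - y') = (x - x') - (y - y')" by simp
  ultimately have "(x - y) - (x' - y') = to_multiplier (a - b)" by (simp only: to_multiplier_simps(4))
  then show "corona_rel (x - y) (x' - y')" by (simp add: corona_rel_def)
qed
lift_definition times_corona :: "'a corona \<Rightarrow> 'a corona \<Rightarrow> 'a corona" is "(*)"
proof -
  fix x x' y y' :: "'a multiplier"
  assume "corona_rel x x'" "corona_rel y y'"
  then obtain a b where "x - x' = to_multiplier a" "y - y' = to_multiplier b" by (auto simp: corona_rel_def)
  moreover have "x * y - x' * y' = (x - x') * y + x' * (y - y')" by (simp add: algebra_simps)
  ultimately have "x * y - x' * y' = to_multiplier (right_mult y a + left_mult x' b)"
    by (simp only: to_multiplier_ideal to_multiplier_simps(2))
  then show "corona_rel (x * y) (x' * y')" by (simp add: corona_rel_def)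
qed
lift_definition star_corona :: "'a corona \<Rightarrow> 'a corona" is star
proof -
  fix x x' :: "'a multiplier" assume "corona_rel x x'"
  then obtain a where "x - x' = to_multiplier a" by (auto simp: corona_rel_def)
  moreover have "star x - star x' = star (x - x')" by (simp only: star_diff)
  ultimately have "star x - star x' = to_multiplier (star a)" by (simp only: to_multiplier_simps(7))
  then show "corona_rel (star x) (star x')" by (simp add: corona_rel_def)
qed

lemma corona_proj_simps:
  "corona_proj (0 :: 'a multiplier) = 0"
  "corona_proj (x + y) = corona_proj x + corona_proj y"
  "corona_proj (- x) = - corona_proj x"
  "corona_proj (x - y) = corona_proj x - corona_proj y"
  "corona_proj (x * y) = corona_proj x * corona_proj y"
  "corona_proj (star x) = star (corona_proj x)"
  by (transfer; simp add: equivp_reflp[OF equivp_corona_rel])+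

lemma corona_proj_cases: obtains y where "x = corona_proj y"
  by transfer (blast intro: equivp_reflp[OF equivp_corona_rel])

instance
proof
  fix a b c :: "'a corona"
  obtain x y z where abc: "a = corona_proj x" "b = corona_proj y" "c = corona_proj z"
    by (metis corona_proj_cases)
  show "a + b + c = a + (b + c)" "a + b = b + a" "0 + a = a" "- a + a = 0" "a - b = a + - b"
    "a * b * c = a * (b * c)" "(a + b) * c = a * c + b * c" "a * (b + c) = a * b + a * c"
    "star (a + b) = star a + star b" "star (a * b) = star b * star a" "star (star a) = a"
    unfolding abc corona_proj_simps[symmetric]
    by (simp_all add: algebra_simps star_add star_mult)
qed

end

lemma corona_proj_eq_iff: "corona_proj x = corona_proj y \<longleftrightarrow> x - y \<in> range to_multiplier"
  by transfer (simp add: corona_rel_def)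


section \<open>The minimal unitization\<close>

text \<open>The minimal unitization, realized as the C*-subalgebra \<open>A + \<complex>1\<close> of \<open>M(A)\<close>. If \<open>A\<close> has
  no unit then \<open>(a, c) \<mapsto> to_multiplier a + c *\<^sub>C 1\<close> is injective by \<open>unitization_inj\<close> below, so this
  is the vector space \<open>A \<oplus> \<complex>\<close> with the norm given by the left action on \<open>A\<close>.\<close>

definition unitization_set :: "'a::cstar_algebra multiplier set" where
  "unitization_set = {to_multiplier a + c *\<^sub>C 1 |a c. True}"

lemma unital_if_one_in_range:
  assumes "to_multiplier (e::'a::cstar_algebra) = 1"
  shows "unital TYPE('a)"
  unfolding unital_def is_unit_elem_def
  by (metis assms to_multiplier_apply id_blinfun.rep_eq left_mult_simps(1) right_mult_simps(1))

lemma unitization_inj: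
  assumes "\<not> unital TYPE('a::cstar_algebra)"
  shows "inj (\<lambda>(a::'a, c). to_multiplier a + c *\<^sub>C 1)"
proof (rule injI, clarify)
  fix a b :: 'a and c d
  assume eq: "to_multiplier a + c *\<^sub>C 1 = to_multiplier b + d *\<^sub>C 1"
  have e: "to_multiplier (a - b) = (d - c) *\<^sub>C 1"
    using eq by (simp add: to_multiplier_simps scaleC_diff_left algebra_simps)
  have "c = d"
  proof (rule ccontr)
    assume "c \<noteq> d"
    then have "to_multiplier (inverse (d - c) *\<^sub>C (a - b)) = 1"
      by (simp only: to_multiplier_simps(6) e) (simp add: scaleC_scaleC)
    with assms unital_if_one_in_range show False by blast
  qed
  then have "norm (to_multiplier (a - b)) = 0" using e by simp
  then show "a = b \<and> c = d" using \<open>c = d\<close> by simp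
qed

typedef (overloaded) 'a unitization = "unitization_set :: 'a::cstar_algebra multiplier set"
  by (auto simp: unitization_set_def)

setup_lifting type_definition_unitization

lemma unitization_setI: "x = to_multiplier a + c *\<^sub>C 1 \<Longrightarrow> x \<in> unitization_set"
  by (auto simp: unitization_set_def)

lemma zero_in_unitization_set: "0 \<in> unitization_set"
  by (rule unitization_setI[of _ 0 0]) (simp add: to_multiplier_simps)

lemma one_in_unitization_set: "1 \<in> unitization_set"
  by (rule unitization_setI[of _ 0 1]) (simp add: to_multiplier_simps)

lemma unitization_set_closed:
  assumes "x \<in> unitization_set" "y \<in> unitization_set"
  shows "x + y \<in> unitization_set" "x - y \<in> unitization_set" "x * y \<in> unitization_set"
    "- x \<in> unitization_set" "star x \<in> unitization_set" "c *\<^sub>C x \<in> unitization_set"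
    "r *\<^sub>R x \<in> unitization_set"
proof -
  obtain a b d e where xy: "x = to_multiplier a + d *\<^sub>C 1" "y = to_multiplier b + e *\<^sub>C 1"
    using assms by (auto simp: unitization_set_def)
  have star1: "star 1 = (1 :: 'a multiplier)" by (rule multiplier_eqI) simp_all
  show "x + y \<in> unitization_set"
    by (rule unitization_setI[of _ "a + b" "d + e"]) (simp add: xy to_multiplier_simps scaleC_add_left)
  show "x - y \<in> unitization_set"
    by (rule unitization_setI[of _ "a - b" "d - e"]) (simp add: xy to_multiplier_simps scaleC_diff_left)
  show "- x \<in> unitization_set"
    by (rule unitization_setI[of _ "- a" "- d"]) (simp add: xy to_multiplier_simps scaleC_minus_left)
  show C: "c *\<^sub>C x \<in> unitization_set" for c
    by (rule unitization_setI[of _ "c *\<^sub>C a" "c * d"])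
      (simp add: xy to_multiplier_simps scaleC_add_right scaleC_scaleC)
  show "r *\<^sub>R x \<in> unitization_set" unfolding scaleR_scaleC by (rule C)
  show "star x \<in> unitization_set"
    by (rule unitization_setI[of _ "star a" "cnj d"]) (simp add: xy to_multiplier_simps star_add star_scaleC star1)
  show "x * y \<in> unitization_set"
    by (rule unitization_setI[of _ "a * b + e *\<^sub>C a + d *\<^sub>C b" "d * e"])
      (simp add: xy to_multiplier_simps algebra_simps mult_scaleC_left mult_scaleC_right scaleC_scaleC scaleC_add_right)
qed

lemma closed_range_to_multiplier: "closed (range (to_multiplier :: 'a::cstar_algebra \<Rightarrow> 'a multiplier))"
proof -
  have "bounded_linear (to_multiplier :: 'a \<Rightarrow> 'a multiplier)"
    by (rule bounded_linear_intro[where K = 1]) (simp_all add: to_multiplier_simps scaleR_scaleC)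
  then show ?thesis
    by (intro complete_imp_closed complete_isometric_image[of 1] subspace_UNIV)
      (auto simp: complete_UNIV)
qed

lemma closed_unitization_set: "closed (unitization_set :: 'a::cstar_algebra multiplier set)"
proof (cases "(1 :: 'a multiplier) \<in> range to_multiplier")
  case True
  then obtain e :: 'a where e: "1 = to_multiplier e" by auto
  have "unitization_set = range (to_multiplier :: 'a \<Rightarrow> 'a multiplier)"
  proof (intro equalityI subsetI)
    fix x :: "'a multiplier" assume "x \<in> unitization_set"
    then obtain a c where "x = to_multiplier a + c *\<^sub>C 1" by (auto simp: unitization_set_def)
    then have "x = to_multiplier (a + c *\<^sub>C e)" by (simp add: to_multiplier_simps e)
    then show "x \<in> range to_multiplier" by simp
  next
    fix x :: "'a multiplier" assume "x \<in> range to_multiplier"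
    then obtain a where "x = to_multiplier a" by auto
    then show "x \<in> unitization_set" by (intro unitization_setI[of _ a 0]) simp
  qed
  then show ?thesis using closed_range_to_multiplier[where ?'a = 'a] by (simp only:)
next
  case False
  define \<delta> where "\<delta> = infdist (1 :: 'a multiplier) (range to_multiplier)"
  have \<delta>: "\<delta> > 0"
    using False closed_range_to_multiplier[where ?'a = 'a] in_closed_iff_infdist_zero[of "range to_multiplier" "1 :: 'a multiplier"]
      infdist_nonneg[of "1 :: 'a multiplier" "range to_multiplier"] by (auto simp: \<delta>_def less_le)
  have lb: "cmod c * \<delta> \<le> norm (to_multiplier a + c *\<^sub>C 1)" for a :: 'a and c
  proof (cases "c = 0")
    case False
    have "\<delta> \<le> dist 1 (to_multiplier (- (inverse c *\<^sub>C a)))" unfolding \<delta>_def by (rule infdist_le) simp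
    also have "\<dots> = norm (inverse c *\<^sub>C (to_multiplier a + c *\<^sub>C 1))"
      using False by (simp add: dist_norm to_multiplier_simps scaleC_add_right scaleC_scaleC add.commute)
    also have "\<dots> = inverse (cmod c) * norm (to_multiplier a + c *\<^sub>C 1)" by (simp add: norm_scaleC norm_inverse)
    finally show ?thesis using False by (simp add: field_simps)
  qed simp
  show ?thesis
    unfolding closed_sequential_limits
  proof (intro allI impI)
    fix X and l :: "'a multiplier"
    assume "(\<forall>n. X n \<in> unitization_set) \<and> X \<longlonglongrightarrow> l"
    then have XU: "\<And>n. \<exists>a c. X n = to_multiplier a + c *\<^sub>C 1" and Xl: "X \<longlonglongrightarrow> l"
      by (auto simp: unitization_set_def)
    then obtain a c where X: "\<And>n. X n = to_multiplier (a n) + c n *\<^sub>C 1" by metis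
    have "Cauchy c"
    proof (rule CauchyI)
      fix e :: real assume "e > 0"
      then obtain M where M: "\<And>m n. m \<ge> M \<Longrightarrow> n \<ge> M \<Longrightarrow> norm (X m - X n) < e * \<delta>"
        using CauchyD[OF LIMSEQ_imp_Cauchy[OF Xl], of "e * \<delta>"] \<delta> by auto
      have "norm (c m - c n) < e" if "m \<ge> M" "n \<ge> M" for m n
      proof -
        have "X m - X n = to_multiplier (a m - a n) + (c m - c n) *\<^sub>C 1"
          by (simp add: X to_multiplier_simps scaleC_diff_left)
        then have "cmod (c m - c n) * \<delta> \<le> norm (X m - X n)"
          using lb[of "c m - c n" "a m - a n"] by (simp only:)
        with M[OF that] \<delta> show ?thesis
          by (smt (verit) mult_less_cancel_right)
      qed
      then show "\<exists>M. \<forall>m\<ge>M. \<forall>n\<ge>M. norm (c m - c n) < e" by blast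
    qed
    then obtain d where d: "c \<longlonglongrightarrow> d" using Cauchy_convergent convergent_def by blast
    have "bounded_linear (\<lambda>z. z *\<^sub>C (1 :: 'a multiplier))"
      by (rule bounded_linear_intro[where K = "norm (1 :: 'a multiplier)"])
        (simp_all add: scaleC_add_left scaleR_scaleC scaleC_scaleC norm_scaleC scaleR_conv_of_real)
    then have "(\<lambda>n. c n *\<^sub>C (1 :: 'a multiplier)) \<longlonglongrightarrow> d *\<^sub>C 1"
      using d by (rule bounded_linear.tendsto)
    from tendsto_diff[OF Xl this] have "(\<lambda>n. to_multiplier (a n)) \<longlonglongrightarrow> l - d *\<^sub>C 1" by (simp add: X)
    then have "l - d *\<^sub>C 1 \<in> range to_multiplier"
      by (rule closed_sequentially[OF closed_range_to_multiplier, rotated]) simp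
    then obtain b where "l - d *\<^sub>C 1 = to_multiplier b" by auto
    then show "l \<in> unitization_set"
      by (intro unitization_setI[of _ b d]) (metis diff_add_cancel)
  qed
qed

instantiation unitization :: (cstar_algebra) real_normed_vector
begin

lift_definition zero_unitization :: "'a unitization" is 0
  by (rule zero_in_unitization_set)
lift_definition plus_unitization :: "'a unitization \<Rightarrow> 'a unitization \<Rightarrow> 'a unitization" is "(+)"
  by (rule unitization_set_closed)
lift_definition uminus_unitization :: "'a unitization \<Rightarrow> 'a unitization" is uminus
  by (rule unitization_set_closed)
lift_definition minus_unitization :: "'a unitization \<Rightarrow> 'a unitization \<Rightarrow> 'a unitization" is "(-)"
  by (rule unitization_set_closed)
lift_definition scaleR_unitization :: "real \<Rightarrow> 'a unitization \<Rightarrow> 'a unitization" is "(*\<^sub>R)"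
  by (rule unitization_set_closed)
lift_definition norm_unitization :: "'a unitization \<Rightarrow> real" is norm .
lift_definition dist_unitization :: "'a unitization \<Rightarrow> 'a unitization \<Rightarrow> real" is dist .

definition sgn_unitization :: "'a unitization \<Rightarrow> 'a unitization" where
  "sgn_unitization x = inverse (norm x) *\<^sub>R x"
definition uniformity_unitization :: "('a unitization \<times> 'a unitization) filter" where
  "uniformity_unitization = (INF e\<in>{0 <..}. principal {(x, y). dist x y < e})"
definition open_unitization :: "'a unitization set \<Rightarrow> bool" where
  "open_unitization S = (\<forall>x\<in>S. \<forall>\<^sub>F (x', y) in uniformity. x' = x \<longrightarrow> y \<in> S)"

lemmas Rep_unitization_vector = zero_unitization.rep_eq plus_unitization.rep_eq uminus_unitization.rep_eq
  minus_unitization.rep_eq scaleR_unitization.rep_eq norm_unitization.rep_eq dist_unitization.rep_eq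

instance
proof
  fix x y z :: "'a unitization" and r s :: real
  show "x + y + z = x + (y + z)" "x + y = y + x" "0 + x = x" "- x + x = 0" "x - y = x + - y"
    "r *\<^sub>R (x + y) = r *\<^sub>R x + r *\<^sub>R y" "(r + s) *\<^sub>R x = r *\<^sub>R x + s *\<^sub>R x"
    "r *\<^sub>R s *\<^sub>R x = (r * s) *\<^sub>R x" "1 *\<^sub>R x = x" "norm x = 0 \<longleftrightarrow> x = 0"
    "norm (r *\<^sub>R x) = \<bar>r\<bar> * norm x" "dist x y = norm (x - y)"
    by (simp_all add: Rep_unitization_inject[symmetric] Rep_unitization_vector scaleR_add_left scaleR_add_right
        add.assoc dist_norm) (simp add: add.commute)?
  show "norm (x + y) \<le> norm x + norm y" by (simp add: Rep_unitization_vector norm_triangle_ineq)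
  show "sgn x = inverse (norm x) *\<^sub>R x" by (fact sgn_unitization_def)
  show "uniformity = (INF e\<in>{0 <..}. principal {(x :: 'a unitization, y). dist x y < e})"
    by (fact uniformity_unitization_def)
  show "open U = (\<forall>x\<in>U. \<forall>\<^sub>F (x', y) in uniformity. x' = x \<longrightarrow> y \<in> U)" for U :: "'a unitization set"
    by (fact open_unitization_def)
qed

end

instantiation unitization :: (cstar_algebra) "{cstar_algebra, monoid_mult}"
begin

lift_definition one_unitization :: "'a unitization" is 1
  by (rule one_in_unitization_set)
lift_definition times_unitization :: "'a unitization \<Rightarrow> 'a unitization \<Rightarrow> 'a unitization" is "(*)"
  by (rule unitization_set_closed)
lift_definition scaleC_unitization :: "complex \<Rightarrow> 'a unitization \<Rightarrow> 'a unitization" is "(*\<^sub>C)"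
  by (rule unitization_set_closed)
lift_definition star_unitization :: "'a unitization \<Rightarrow> 'a unitization" is star
  by (rule unitization_set_closed)

lemmas Rep_unitization_algebra = Rep_unitization_vector one_unitization.rep_eq
  times_unitization.rep_eq scaleC_unitization.rep_eq star_unitization.rep_eq

instance
proof
  fix X :: "nat \<Rightarrow> 'a unitization" assume "Cauchy X"
  then have "Cauchy (\<lambda>n. Rep_unitization (X n))"
    by (simp add: Cauchy_def dist_unitization.rep_eq)
  then obtain l where l: "(\<lambda>n. Rep_unitization (X n)) \<longlonglongrightarrow> l"
    using Cauchy_convergent convergent_def by blast
  then have "l \<in> unitization_set"
    using closed_unitization_set Rep_unitization by (metis closed_sequentially)
  with l have "X \<longlonglongrightarrow> Abs_unitization l"
    by (simp add: lim_sequentially dist_unitization.rep_eq Abs_unitization_inverse)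
  then show "convergent X" by (auto simp: convergent_def)
next
  fix x y z :: "'a unitization" and r :: real and c d :: complex
  show "x * y * z = x * (y * z)" "(x + y) * z = x * z + y * z" "x * (y + z) = x * y + x * z"
    "1 * x = x" "x * 1 = x" "r *\<^sub>R x * y = r *\<^sub>R (x * y)" "x * r *\<^sub>R y = r *\<^sub>R (x * y)"
    by (simp_all add: Rep_unitization_inject[symmetric] Rep_unitization_algebra mult.assoc distrib_left distrib_right)
  show "norm (x * y) \<le> norm x * norm y" by (simp add: Rep_unitization_algebra norm_mult_ineq)
  show "star (x + y) = star x + star y" by (simp add: Rep_unitization_inject[symmetric] Rep_unitization_algebra star_add)
  show "star (x * y) = star y * star x" by (simp add: Rep_unitization_inject[symmetric] Rep_unitization_algebra star_mult)
  show "star (star x) = x" by (simp add: Rep_unitization_inject[symmetric] Rep_unitization_algebra)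
  show "c *\<^sub>C (x + y) = c *\<^sub>C x + c *\<^sub>C y" by (simp add: Rep_unitization_inject[symmetric] Rep_unitization_algebra scaleC_add_right)
  show "(c + d) *\<^sub>C x = c *\<^sub>C x + d *\<^sub>C x" by (simp add: Rep_unitization_inject[symmetric] Rep_unitization_algebra scaleC_add_left)
  show "c *\<^sub>C d *\<^sub>C x = (c * d) *\<^sub>C x" by (simp add: Rep_unitization_inject[symmetric] Rep_unitization_algebra scaleC_scaleC)
  show "r *\<^sub>R x = complex_of_real r *\<^sub>C x" by (simp add: Rep_unitization_inject[symmetric] Rep_unitization_algebra scaleR_scaleC)
  show "norm (c *\<^sub>C x) = cmod c * norm x" by (simp add: Rep_unitization_algebra norm_scaleC)
  show "(c *\<^sub>C x) * y = c *\<^sub>C (x * y)" by (simp add: Rep_unitization_inject[symmetric] Rep_unitization_algebra mult_scaleC_left)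
  show "x * (c *\<^sub>C y) = c *\<^sub>C (x * y)" by (simp add: Rep_unitization_inject[symmetric] Rep_unitization_algebra mult_scaleC_right)
  show "star (c *\<^sub>C x) = cnj c *\<^sub>C star x" by (simp add: Rep_unitization_inject[symmetric] Rep_unitization_algebra star_scaleC)
  show "norm (star x * x) = (norm x)\<^sup>2" by (simp add: Rep_unitization_algebra cstar_identity)
qed

end


section \<open>Real rank and extension real rank\<close>

definition real_rank :: "'a::cstar_algebra itself \<Rightarrow> enat" where
  "real_rank _ = (if unital TYPE('a) then real_rank_unital TYPE('a)
                  else real_rank_unital TYPE('a unitization))"

definition property_Lambda :: "'a::cstar_algebra itself \<Rightarrow> nat \<Rightarrow> bool" where
  "property_Lambda _ n \<longleftrightarrow>
    (\<forall>a \<in> {..<Suc n} \<rightarrow>\<^sub>E (self_adjoint :: 'a multiplier set).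
      (\<lambda>j\<in>{..<Suc n}. corona_proj (a j)) \<in> Lg (Suc n) \<longrightarrow>
      (\<forall>\<epsilon>>0. \<exists>b \<in> Lg (Suc n). \<forall>j<Suc n.
        norm (a j - b j) < \<epsilon> \<and> corona_proj (a j) = corona_proj (b j)))"

definition ext_real_rank :: "'a::cstar_algebra itself \<Rightarrow> enat" where
  "ext_real_rank T = Inf {enat n |n. \<forall>m\<ge>n. property_Lambda T m}"

end

theory Submission
  imports Defs
begin

text \<open>For \<open>rr(A) \<le> xrr(A)\<close> with \<open>A\<close> nonunital, a self-adjoint tuple of the unitization is moved slightly
  so that some scalar part is nonzero. It then generates the quotient \<open>M(A)/A\<close>, and a tuple supplied by
  \<open>\<Lambda>\<^sub>n\<close> differs from it by elements of \<open>A\<close>, hence stays in the unitization.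

  For \<open>xrr(A) \<le> rr(M(A))\<close>, let \<open>\<Sum>a\<^sub>k\<^sup>2\<close> be invertible modulo \<open>A\<close> and let \<open>c\<close> be a close tuple with
  \<open>\<Sum>c\<^sub>k\<^sup>2\<close> invertible. With \<open>d = c - a\<close> and a quasicentral approximate unit \<open>h\<close> of \<open>A\<close>, put
  \<open>b\<^sub>k = a\<^sub>k + (h d\<^sub>k + d\<^sub>k h) / 2\<close>. If all \<open>b\<^sub>k \<xi>\<close> are small, then commuting \<open>1 - h\<close> past everything shows that
  \<open>\<zeta> = (1 - h) \<xi>\<close> is small, because \<open>a\<close> is bounded below modulo \<open>A\<close> and \<open>d\<close> is small against that bound.
  Hence \<open>c\<^sub>k \<xi> = b\<^sub>k \<xi> + d\<^sub>k \<zeta>\<close> up to a small error, so \<open>\<xi>\<close> is small as well.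

  Positivity is handled without spectral theory: \<open>a\<close> is positive if \<open>\<parallel>t - a\<parallel> \<le> t\<close> for some \<open>t\<close>, and square
  roots come from the contraction \<open>s \<mapsto> (y + s\<^sup>2) / 2\<close>, whose fixed point satisfies \<open>(1 - s)\<^sup>2 = 1 - y\<close>.\<close>

section \<open>Inverses and square roots\<close>

lemma star_one [simp]: "star 1 = (1::'a::{cstar_algebra,monoid_mult})"
  by (metis mult_1_right star_mult star_star mult_1_left)

lemma norm_one_le: "norm (1::'a::{cstar_algebra,monoid_mult}) \<le> 1"
  using cstar_identity[of "1::'a"] by (cases "norm (1::'a) = 0") (auto simp: power2_eq_square)

lemma norm_scaleR_one_le: "0 \<le> t \<Longrightarrow> norm (t *\<^sub>R (1::'a::{cstar_algebra,monoid_mult})) \<le> t"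
  using mult_left_mono[OF norm_one_le[where ?'a = 'a], of t] by simp

lemma self_adjoint_simps [simp]:
  "0 \<in> self_adjoint" "1 \<in> (self_adjoint :: 'a::{cstar_algebra,monoid_mult} set)"
  by (simp_all add: self_adjoint_def)

lemma self_adjoint_intros [intro!]:
  fixes a b :: "'a::cstar_algebra"
  shows "a \<in> self_adjoint \<Longrightarrow> b \<in> self_adjoint \<Longrightarrow> a + b \<in> self_adjoint"
    "a \<in> self_adjoint \<Longrightarrow> b \<in> self_adjoint \<Longrightarrow> a - b \<in> self_adjoint"
    "a \<in> self_adjoint \<Longrightarrow> r *\<^sub>R a \<in> self_adjoint"
    "a \<in> self_adjoint \<Longrightarrow> a * a \<in> self_adjoint"
    "a \<in> self_adjoint \<Longrightarrow> b \<in> self_adjoint \<Longrightarrow> a * b * a \<in> self_adjoint"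
  by (simp_all add: self_adjoint_def star_add star_diff star_minus star_scaleR star_mult mult.assoc)

lemma self_adjoint_commuting_mult:
  "a \<in> self_adjoint \<Longrightarrow> b \<in> self_adjoint \<Longrightarrow> a * b = b * a \<Longrightarrow> a * b \<in> self_adjoint"
  by (simp add: self_adjoint_def star_mult)

lemma self_adjoint_sum:
  "(\<And>k. k \<in> I \<Longrightarrow> f k \<in> self_adjoint) \<Longrightarrow> sum f I \<in> (self_adjoint :: 'a::cstar_algebra set)"
  by (induction I rule: infinite_finite_induct) auto

lemma continuous_on_star: "continuous_on UNIV (star :: 'a \<Rightarrow> 'a::cstar_algebra)"
proof -
  have "bounded_linear (star :: 'a \<Rightarrow> 'a)"
    by (rule bounded_linear_intro[where K = 1]) (simp_all add: star_add star_scaleR)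
  then show ?thesis by (rule linear_continuous_on)
qed

section \<open>Invertible elements and the Neumann series\<close>

lemma is_unit_elem_iff: "is_unit_elem e \<longleftrightarrow> e = (1::'a::{ring,monoid_mult})"
  unfolding is_unit_elem_def by (metis mult_1_left mult_1_right)

lemma invertible_elem_iff:
  "invertible_elem x \<longleftrightarrow> (\<exists>y. x * y = 1 \<and> y * x = (1::'a::{ring,monoid_mult}))"
  by (simp add: invertible_elem_def is_unit_elem_iff)

lemma inverse_unique: "y * x = 1 \<Longrightarrow> x * z = 1 \<Longrightarrow> y = (z::'a::monoid_mult)"
  by (metis mult.assoc mult_1_left mult_1_right)

text \<open>Taking adjoints turns the right inverse \<open>y\<close> into the left inverse
  \<open>star y\<close>, and a left and a right inverse agree.\<close>

lemma inverse_self_adjoint: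
  assumes "x * y = 1" "x \<in> self_adjoint"
  shows "y \<in> (self_adjoint :: 'a::{cstar_algebra,monoid_mult} set)" "y * x = 1"
proof -
  have "star y * x = 1" using arg_cong[OF assms(1), of star] assms(2) by (simp add: star_mult self_adjoint_def)
  then have "star y = y" using assms(1) by (rule inverse_unique)
  then show "y \<in> self_adjoint" "y * x = 1" using \<open>star y * x = 1\<close> by (auto simp: self_adjoint_def)
qed

lemma mult_cancel_inner: "b * c = 1 \<Longrightarrow> a * b * (c * d) = a * (d::'a::monoid_mult)"
  by (metis mult.assoc mult_1_left)

lemma inverse_commutes:
  assumes "x * y = 1" "y * x = (1::'a::monoid_mult)" "z * x = x * z"
  shows "z * y = y * z"
proof -
  have "z * y = y * (x * z) * y" using assms(2) by (simp flip: mult.assoc)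
  also have "\<dots> = y * z * (x * y)" by (simp add: assms(3)[symmetric] mult.assoc)
  finally show ?thesis by (simp add: assms(1))
qed

lemma invertible_elem_mult:
  fixes x y :: "'a::{ring,monoid_mult}"
  assumes "invertible_elem x" "invertible_elem y"
  shows "invertible_elem (x * y)"
proof -
  obtain u v where "x * u = 1" "u * x = 1" "y * v = 1" "v * y = 1"
    using assms by (auto simp: invertible_elem_iff)
  then have "x * y * (v * u) = 1" "v * u * (x * y) = 1"
    by (simp_all add: mult_cancel_inner)
  then show ?thesis by (auto simp: invertible_elem_iff)
qed

lemma invertible_elem_scaleR:
  fixes x :: "'a::{cstar_algebra,monoid_mult}"
  assumes "invertible_elem x" "r \<noteq> 0"
  shows "invertible_elem (r *\<^sub>R x)"
proof -
  obtain y where "x * y = 1" "y * x = 1" using assms by (auto simp: invertible_elem_iff)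
  then have "r *\<^sub>R x * (inverse r *\<^sub>R y) = 1" "inverse r *\<^sub>R y * (r *\<^sub>R x) = 1"
    using assms(2) by simp_all
  then show ?thesis unfolding invertible_elem_iff by blast
qed

text \<open>A solution of \<open>a * x = 1\<close> is a fixed point of
  \<open>x \<mapsto> 1 + (1 - a) * x\<close>, which contracts with constant
  \<open>norm (1 - a)\<close>.\<close>

lemma Neumann_right_inverse:
  fixes a :: "'a::{cstar_algebra,monoid_mult}"
  assumes "norm (1 - a) < 1"
  shows "\<exists>x. a * x = 1"
proof -
  have "\<exists>!x\<in>UNIV. 1 + (1 - a) * x = x"
  proof (rule Banach_fix[where c = "norm (1 - a)"])
    show "dist (1 + (1 - a) * x) (1 + (1 - a) * y) \<le> norm (1 - a) * dist x y" for x y :: 'a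
      using norm_mult_ineq[of "1 - a" "x - y"] by (simp add: dist_norm algebra_simps)
  qed (use assms in \<open>auto simp: complete_UNIV\<close>)
  then obtain x where "1 + (1 - a) * x = x" by blast
  then have "a * x = 1" by (simp add: algebra_simps)
  then show ?thesis ..
qed

lemma Neumann_invertible:
  fixes a :: "'a::{cstar_algebra,monoid_mult}"
  assumes "norm (1 - a) < 1"
  shows "invertible_elem a"
proof -
  obtain x where x: "a * x = 1" using Neumann_right_inverse[OF assms] ..
  \<comment> \<open>Applied to \<open>star a\<close>, the same argument gives a left inverse of
    \<open>a\<close>.\<close>
  have "norm (1 - star a) < 1" using norm_star[of "1 - a"] assms by (simp add: star_diff del: norm_star)
  then obtain y where "star a * y = 1" using Neumann_right_inverse by blast
  then have y: "star y * a = 1" using star_mult[of "star a" y] by simp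
  have "star y = x" using y x by (rule inverse_unique)
  then show ?thesis using x y by (auto simp: invertible_elem_iff)
qed

text \<open>The commutation clause lets later arguments choose square roots that commute with each
  other.\<close>

lemma sqrt_one_minus:
  fixes y :: "'a::{cstar_algebra,monoid_mult}"
  assumes y: "y \<in> self_adjoint" and ny: "norm y < 1"
  obtains w where "w \<in> self_adjoint" "w * w = 1 - y" "\<And>z. z * y = y * z \<Longrightarrow> z * w = w * z"
proof -
  \<comment> \<open>\<open>\<rho>\<close> is the smaller root of
    \<open>\<rho>\<^sup>2 - 2 * \<rho> + norm y = 0\<close>: the ball of this radius is mapped into
    itself, and \<open>\<rho> < 1\<close> is a contraction constant on it.\<close>
  define \<rho> where "\<rho> = 1 - sqrt (1 - norm y)"
  have \<rho>: "0 \<le> \<rho>" "\<rho> < 1" using ny by (auto simp: \<rho>_def)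
  have \<rho>2: "norm y + \<rho> * \<rho> = 2 * \<rho>"
    using ny by (simp add: \<rho>_def algebra_simps)
  \<comment> \<open>Self-adjointness and commutation with the commutant of \<open>y\<close> are
    closed conditions preserved by \<open>f\<close>, so the fixed point inherits them.\<close>
  define X where "X = {s \<in> cball 0 \<rho>. star s = s \<and> (\<forall>z. z * y = y * z \<longrightarrow> z * s = s * z)}"
  define f where "f s = (1/2) *\<^sub>R (y + s * s)" for s :: 'a
  have "closed (\<Inter>z\<in>{z. z * y = y * z}. {s. z * s = s * z})"
    by (intro closed_INT ballI closed_Collect_eq continuous_intros)
  moreover have "closed {s::'a. star s = s}"
    by (intro closed_Collect_eq continuous_on_star continuous_intros)
  moreover have "X = cball 0 \<rho> \<inter> {s. star s = s} \<inter> (\<Inter>z\<in>{z. z * y = y * z}. {s. z * s = s * z})"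
    by (auto simp: X_def)
  ultimately have "closed X" by (simp only:) (intro closed_Int closed_cball)
  have "\<exists>!s\<in>X. f s = s"
  proof (rule Banach_fix[where c = \<rho>])
    show "complete X" using \<open>closed X\<close> by (simp add: complete_eq_closed)
    show "X \<noteq> {}" using \<rho> by (auto simp: X_def intro!: exI[of _ 0])
    show "f ` X \<subseteq> X"
    proof (clarify)
      fix s assume s: "s \<in> X"
      then have ns: "norm s \<le> \<rho>" and ss: "star s = s"
        and comm: "\<And>z. z * y = y * z \<Longrightarrow> z * s = s * z" by (auto simp: X_def)
      have "norm (y + s * s) \<le> norm y + norm s * norm s"
        by (rule order_trans[OF norm_triangle_ineq add_left_mono[OF norm_mult_ineq]])
      also have "\<dots> \<le> 2 * \<rho>" using mult_mono[OF ns ns] \<rho> \<rho>2 by simp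
      finally have "norm (f s) \<le> \<rho>" by (simp add: f_def)
      moreover have "star (f s) = f s"
        using ss y by (simp add: f_def star_scaleR star_add star_mult self_adjoint_def)
      moreover have "z * f s = f s * z" if z: "z * y = y * z" for z
      proof -
        have "z * s = s * z" using z by (rule comm)
        then have "z * (s * s) = s * s * z" by (metis mult.assoc)
        then show ?thesis using z by (simp add: f_def distrib_left distrib_right)
      qed
      ultimately show "f s \<in> X" unfolding X_def by simp
    qed
    show "dist (f s) (f t) \<le> \<rho> * dist s t" if "s \<in> X" "t \<in> X" for s t
    proof -
      have n: "norm s \<le> \<rho>" "norm t \<le> \<rho>" using that by (auto simp: X_def)
      have "f s - f t = (1/2) *\<^sub>R (s * (s - t) + (s - t) * t)"
        by (simp add: f_def algebra_simps)
      also have "norm \<dots> \<le> 1/2 * (norm s * norm (s - t) + norm (s - t) * norm t)"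
        using norm_triangle_ineq[of "s * (s - t)" "(s - t) * t"]
          norm_mult_ineq[of s "s - t"] norm_mult_ineq[of "s - t" t] by simp
      also have "\<dots> \<le> 1/2 * (\<rho> * norm (s - t) + norm (s - t) * \<rho>)"
        using n by (intro mult_left_mono add_mono mult_right_mono) auto
      finally show ?thesis by (simp add: dist_norm algebra_simps)
    qed
  qed (use \<rho> in auto)
  then obtain s where "s \<in> X" and fs: "f s = s" by blast
  then have ss: "star s = s" and comm: "\<And>z. z * y = y * z \<Longrightarrow> z * s = s * z"
    by (auto simp: X_def)
  have "2 *\<^sub>R f s = y + s * s" by (simp add: f_def)
  then have "s + s = y + s * s" by (simp add: fs scaleR_2)
  then have "(1 - s) * (1 - s) = 1 - y" by (simp add: algebra_simps)
  moreover have "1 - s \<in> self_adjoint" using ss by (simp add: self_adjoint_def star_diff)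
  moreover have "z * (1 - s) = (1 - s) * z" if "z * y = y * z" for z
    using comm[OF that] by (simp add: left_diff_distrib right_diff_distrib)
  ultimately show thesis using that by blast
qed

text \<open>If \<open>p\<^sup>2 + q\<^sup>2 = t\<close> then \<open>p + iq\<close> is \<open>sqrt t\<close> times a unitary, and \<open>p\<close> is its real part.\<close>

lemma norm_sq_le_of_commuting_squares:
  fixes p q :: "'a::{cstar_algebra,monoid_mult}"
  assumes sa: "p \<in> self_adjoint" "q \<in> self_adjoint" and pq: "p * q = q * p"
    and t: "p * p + q * q = t *\<^sub>R 1" "0 \<le> t"
  shows "(norm p)\<^sup>2 \<le> t"
proof -
  define u where "u = p + \<i> *\<^sub>C q"
  have su: "star u = p - \<i> *\<^sub>C q"
    using sa by (simp add: u_def star_add star_scaleC self_adjoint_def scaleC_minus_left)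
  have "star u * u = p * p + q * q"
    unfolding su unfolding u_def
    by (simp add: algebra_simps mult_scaleC_left mult_scaleC_right scaleC_scaleC pq scaleC_minus_left scaleC_diff_right)
  then have "(norm u)\<^sup>2 \<le> t"
    using cstar_identity[of u] norm_scaleR_one_le[OF t(2), where ?'a = 'a] t(1) by (simp del: norm_scaleR)
  moreover have "2 *\<^sub>R p = u + star u" unfolding su by (simp add: u_def scaleR_2)
  then have "2 * norm p \<le> norm u + norm u"
    using norm_triangle_ineq[of u "star u"] by (metis norm_scaleR norm_star abs_numeral)
  then have "(norm p)\<^sup>2 \<le> (norm u)\<^sup>2" by (intro power_mono) auto
  ultimately show ?thesis by linarith
qed

section \<open>Positive elements\<close>

text \<open>The norm bound places the spectrum of a self-adjoint \<open>a\<close> between 0 and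
  \<open>2 * t\<close>, so this is the usual positive cone. In this form sums follow from the
  triangle inequality.\<close>

definition pos :: "'a::{cstar_algebra,monoid_mult} set" where
  "pos = {a \<in> self_adjoint. \<exists>t. norm (t *\<^sub>R 1 - a) \<le> t}"

lemma pos_self_adjoint: "a \<in> pos \<Longrightarrow> a \<in> self_adjoint"
  by (simp add: pos_def)

lemma pos_add: "a \<in> pos \<Longrightarrow> b \<in> pos \<Longrightarrow> a + b \<in> pos"
proof -
  assume "a \<in> pos" "b \<in> pos"
  then obtain s t where ab: "a \<in> self_adjoint" "b \<in> self_adjoint"
    and "norm (s *\<^sub>R 1 - a) \<le> s" "norm (t *\<^sub>R 1 - b) \<le> t"
    by (auto simp: pos_def)
  moreover have "(s + t) *\<^sub>R 1 - (a + b) = (s *\<^sub>R 1 - a) + (t *\<^sub>R 1 - b)" by (simp add: algebra_simps)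
  ultimately have "norm ((s + t) *\<^sub>R 1 - (a + b)) \<le> s + t"
    by (metis norm_triangle_mono)
  then show ?thesis using ab by (auto simp: pos_def)
qed

lemma pos_scaleR_one: "0 \<le> t \<Longrightarrow> t *\<^sub>R 1 \<in> pos"
  by (auto simp: pos_def intro!: exI[of _ t] self_adjoint_intros)

lemma pos_zero [simp]: "0 \<in> pos"
  using pos_scaleR_one[of 0] by simp

lemma pos_sum: "(\<And>k. k \<in> I \<Longrightarrow> f k \<in> pos) \<Longrightarrow> sum f I \<in> pos"
  by (induction I rule: infinite_finite_induct) (auto intro: pos_add)

lemma pos_scaleR: "a \<in> pos \<Longrightarrow> 0 \<le> r \<Longrightarrow> r *\<^sub>R a \<in> pos"
proof -
  assume a: "a \<in> pos" and r: "0 \<le> r"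
  then obtain t where "a \<in> self_adjoint" "norm (t *\<^sub>R 1 - a) \<le> t" by (auto simp: pos_def)
  moreover have "(r * t) *\<^sub>R 1 - r *\<^sub>R a = r *\<^sub>R (t *\<^sub>R 1 - a)" by (simp add: algebra_simps)
  ultimately have "norm ((r * t) *\<^sub>R 1 - r *\<^sub>R a) \<le> r * t" using r by (simp add: mult_left_mono)
  then show ?thesis using \<open>a \<in> self_adjoint\<close> by (auto simp: pos_def)
qed

text \<open>\<open>t *\<^sub>R 1 - a * a\<close> has a self-adjoint root \<open>q\<close> commuting
  with \<open>a\<close>, and \<open>a * a + q * q\<close> is the scalar \<open>t\<close>, which
  bounds \<open>norm q\<close>.\<close>

lemma norm_diff_square_le:
  fixes a :: "'a::{cstar_algebra,monoid_mult}"
  assumes a: "a \<in> self_adjoint" and t: "(norm a)\<^sup>2 < t"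
  shows "norm (t *\<^sub>R 1 - a * a) \<le> t"
proof -
  have t0: "0 < t" using t by (smt (verit) zero_le_power2)
  define y where "y = inverse t *\<^sub>R (a * a)"
  have "norm y < 1"
    using t t0 norm_mult_ineq[of a a] by (simp add: y_def field_simps power2_eq_square)
  moreover have "y \<in> self_adjoint" using a by (auto simp: y_def)
  moreover have "a * y = y * a" by (simp add: y_def mult.assoc)
  ultimately obtain w where w: "w \<in> self_adjoint" "w * w = 1 - y" "a * w = w * a"
    by (metis sqrt_one_minus)
  define q where "q = sqrt t *\<^sub>R w"
  have qq: "q * q = t *\<^sub>R 1 - a * a"
    using t0 by (simp add: q_def w(2) y_def algebra_simps)
  have "(norm q)\<^sup>2 \<le> t"
    by (rule norm_sq_le_of_commuting_squares[of _ a])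
      (use a w t0 qq in \<open>auto simp: q_def\<close>)
  then show ?thesis using norm_mult_ineq[of q q] by (simp add: qq power2_eq_square)
qed

lemma pos_square: "a \<in> self_adjoint \<Longrightarrow> a * a \<in> pos"
  using norm_diff_square_le[of a "(norm a)\<^sup>2 + 1"] by (auto simp: pos_def)

text \<open>The contraction needs a norm strictly below 1. The shift by \<open>\<eta>\<close>
  provides it: the shifted element is \<open>T\<close> times \<open>1 - y\<close> with
  \<open>norm y < 1\<close>.\<close>

lemma pos_sqrt:
  assumes a: "a \<in> pos" and \<eta>: "0 < \<eta>"
  obtains s where "s \<in> self_adjoint" "s * s = a + \<eta> *\<^sub>R 1" "\<And>z. z * a = a * z \<Longrightarrow> z * s = s * z"
proof -
  obtain t where asa: "a \<in> self_adjoint" and t: "norm (t *\<^sub>R 1 - a) \<le> t" using a by (auto simp: pos_def)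
  have t0: "0 \<le> t" using t norm_ge_zero order_trans by blast
  define T where "T = t + \<eta>"
  have T: "T > 0" using t0 \<eta> by (simp add: T_def)
  define y where "y = inverse T *\<^sub>R (t *\<^sub>R 1 - a)"
  have ys: "y \<in> self_adjoint" using asa by (auto simp: y_def)
  have "norm y = norm (t *\<^sub>R 1 - a) / T" using T by (simp add: y_def divide_inverse)
  then have "norm y < 1" using t \<eta> T by (simp add: T_def)
  with ys obtain w where w: "w \<in> self_adjoint" "w * w = 1 - y" "\<And>z. z * y = y * z \<Longrightarrow> z * w = w * z"
    by (metis sqrt_one_minus)
  show thesis
  proof
    show "sqrt T *\<^sub>R w \<in> self_adjoint" using w(1) by auto
    show "sqrt T *\<^sub>R w * sqrt T *\<^sub>R w = a + \<eta> *\<^sub>R 1"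
      using T by (simp add: w(2) y_def algebra_simps) (simp add: T_def algebra_simps)
    show "z * sqrt T *\<^sub>R w = sqrt T *\<^sub>R w * z" if "z * a = a * z" for z
      using w(3)[of z] that by (simp add: y_def algebra_simps)
  qed
qed

text \<open>\<open>T\<close> is independent of the shift \<open>e\<close>: writing
  \<open>a + e\<close> as a square \<open>s * s\<close> bounds \<open>T + e - s * s = T - a\<close>
  by \<open>T + e\<close>, and \<open>e\<close> is arbitrary.\<close>

lemma pos_closed:
  assumes a: "a \<in> self_adjoint" and pos: "\<And>\<eta>. 0 < \<eta> \<Longrightarrow> a + \<eta> *\<^sub>R 1 \<in> pos"
  shows "a \<in> pos"
proof -
  define T where "T = norm a + 1"
  have "norm (T *\<^sub>R 1 - a) \<le> T"
  proof (rule field_le_epsilon)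
    fix e :: real assume "0 < e"
    \<comment> \<open>One half of \<open>e\<close> makes the element positive, the other half is
      spent on its square root.\<close>
    define \<eta> where "\<eta> = e / 2"
    have \<eta>: "0 < \<eta>" "e = 2 * \<eta>" using \<open>0 < e\<close> by (auto simp: \<eta>_def)
    obtain s where s: "s \<in> self_adjoint" "s * s = (a + \<eta> *\<^sub>R 1) + \<eta> *\<^sub>R 1"
      using pos_sqrt[OF pos[OF \<eta>(1)] \<eta>(1)] by metis
    then have ss: "s * s = a + e *\<^sub>R 1" by (simp add: \<eta>(2) scaleR_add_left[symmetric] add.assoc)
    have "(norm s)\<^sup>2 = norm (a + e *\<^sub>R 1)"
      using cstar_identity[of s] s ss by (simp add: self_adjoint_def)
    also have "\<dots> \<le> norm a + e"
      using norm_triangle_ineq[of a "e *\<^sub>R 1"] norm_scaleR_one_le[of e, where ?'a = 'a] \<open>0 < e\<close> by linarith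
    finally have "norm ((T + e) *\<^sub>R 1 - s * s) \<le> T + e"
      by (intro norm_diff_square_le s) (simp add: T_def)
    then show "norm (T *\<^sub>R 1 - a) \<le> T + e" by (simp add: ss algebra_simps)
  qed
  then show ?thesis using a by (auto simp: pos_def)
qed

text \<open>Up to small shifts, \<open>q\<close> and \<open>s - q\<close> have commuting square
  roots \<open>w\<close> and \<open>v\<close> whose squares add up to a scalar, which bounds
  \<open>norm w\<close>.\<close>

lemma norm_le_of_pos:
  assumes q: "q \<in> pos" "s *\<^sub>R 1 - q \<in> pos" and s: "0 \<le> s"
  shows "norm q \<le> s"
proof (rule field_le_epsilon)
  fix e :: real assume "0 < e"
  \<comment> \<open>The bound on \<open>w * w\<close> costs two copies of \<open>\<eta>\<close>, and
    passing back from \<open>w * w\<close> to \<open>q\<close> costs a third.\<close>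
  define \<eta> where "\<eta> = e / 3"
  have \<eta>: "0 < \<eta>" "e = 3 * \<eta>" using \<open>0 < e\<close> by (auto simp: \<eta>_def)
  obtain w where w: "w \<in> self_adjoint" "w * w = q + \<eta> *\<^sub>R 1" "q * w = w * q"
    using pos_sqrt[OF q(1) \<eta>(1)] by metis
  have "w * (s *\<^sub>R 1 - q) = (s *\<^sub>R 1 - q) * w" using w(3) by (simp add: algebra_simps)
  then obtain v where v: "v \<in> self_adjoint" "v * v = s *\<^sub>R 1 - q + \<eta> *\<^sub>R 1" "w * v = v * w"
    using pos_sqrt[OF q(2) \<eta>(1)] by metis
  have "w * w + v * v = s *\<^sub>R 1 + \<eta> *\<^sub>R 1 + \<eta> *\<^sub>R 1"
    by (simp add: v(2) w(2))
  also have "\<dots> = (s + 2 * \<eta>) *\<^sub>R 1"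
    by (simp flip: scaleR_add_left)
  finally have "(norm w)\<^sup>2 \<le> s + 2 * \<eta>"
    by (rule norm_sq_le_of_commuting_squares[OF w(1) v(1) v(3)]) (use s \<eta> in auto)
  moreover have "q = w * w - \<eta> *\<^sub>R 1" by (simp add: w(2))
  then have "norm q \<le> norm (w * w) + norm (\<eta> *\<^sub>R (1::'a))" by (simp only: norm_triangle_ineq4)
  ultimately show "norm q \<le> s + e"
    using norm_mult_ineq[of w w] norm_scaleR_one_le[of \<eta>, where ?'a = 'a] \<eta>
    unfolding power2_eq_square by linarith
qed

text \<open>With \<open>T = t + \<delta>\<close>, the element \<open>x\<close> lies within
  \<open>t < T\<close> of \<open>T *\<^sub>R 1\<close>, which is in the range of the Neumann
  series.\<close>

lemma invertible_of_pos_diff: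
  assumes "x - \<delta> *\<^sub>R 1 \<in> pos" "0 < \<delta>"
  shows "invertible_elem (x :: 'a::{cstar_algebra,monoid_mult})"
proof -
  obtain t where t: "norm (t *\<^sub>R 1 - (x - \<delta> *\<^sub>R 1)) \<le> t" using assms by (auto simp: pos_def)
  define T where "T = t + \<delta>"
  have "0 \<le> t" using t norm_ge_zero order_trans by blast
  then have T: "0 < T" using assms(2) by (simp add: T_def)
  have n: "norm (T *\<^sub>R 1 - x) < T" using t assms(2) by (simp add: T_def algebra_simps)
  have "1 - inverse T *\<^sub>R x = inverse T *\<^sub>R (T *\<^sub>R 1 - x)" using T by (simp add: algebra_simps)
  then have "norm (1 - inverse T *\<^sub>R x) = norm (T *\<^sub>R 1 - x) / T"
    using T by (simp only: norm_scaleR) (simp add: divide_inverse)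
  then have "norm (1 - inverse T *\<^sub>R x) < 1" using n T by simp
  then have "invertible_elem (inverse T *\<^sub>R x)" by (rule Neumann_invertible)
  from invertible_elem_scaleR[OF this, of T] T show ?thesis by simp
qed

text \<open>For \<open>y\<close> inverse to \<open>x\<close> and small \<open>\<delta>\<close>,
  \<open>1 - \<delta> *\<^sub>R y\<close> is a square \<open>w * w\<close>. So
  \<open>x - \<delta> *\<^sub>R 1 = x * (w * w)\<close> is a product of commuting positive elements,
  hence a limit of squares.\<close>

lemma pos_invertible_lower_bound:
  assumes x: "x \<in> pos" and inv: "invertible_elem x"
  obtains \<delta> where "0 < \<delta>" "x - \<delta> *\<^sub>R 1 \<in> pos"
proof -
  obtain y where y: "x * y = 1" "y * x = 1" using inv by (auto simp: invertible_elem_iff)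
  note xs = pos_self_adjoint[OF x]
  have ysa: "y \<in> self_adjoint" using inverse_self_adjoint[OF y(1) xs] by simp
  define \<delta> where "\<delta> = inverse (norm y + 1)"
  have \<delta>: "0 < \<delta>" by (simp add: \<delta>_def add_nonneg_pos)
  have n: "norm (\<delta> *\<^sub>R y) < 1"
    by (simp add: \<delta>_def add_nonneg_pos divide_simps)
  obtain w where w: "w \<in> self_adjoint" "w * w = 1 - \<delta> *\<^sub>R y"
      "\<And>z. z * (\<delta> *\<^sub>R y) = \<delta> *\<^sub>R y * z \<Longrightarrow> z * w = w * z"
    using sqrt_one_minus[of "\<delta> *\<^sub>R y"] ysa n by blast
  have wx: "w * x = x * w" using w(3)[of x] y by simp
  have "x - \<delta> *\<^sub>R 1 \<in> pos"
  proof (rule pos_closed)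
    show "x - \<delta> *\<^sub>R 1 \<in> self_adjoint" using xs by auto
    fix e :: real assume e: "0 < e"
    define \<eta> where "\<eta> = e / 2"
    have \<eta>: "0 < \<eta>" and e\<eta>: "e *\<^sub>R (1::'a) = \<eta> *\<^sub>R 1 + \<eta> *\<^sub>R 1"
      using e by (auto simp: \<eta>_def simp flip: scaleR_add_left)
    obtain s where s: "s \<in> self_adjoint" "s * s = x + \<eta> *\<^sub>R 1" "w * s = s * w"
      using pos_sqrt[OF x \<eta>] wx by metis
    have "s * w * (s * w) = (s * s) * (w * w)" by (metis s(3) mult.assoc)
    also have "\<dots> = x - \<delta> *\<^sub>R 1 + \<eta> *\<^sub>R (1 - \<delta> *\<^sub>R y)"
      by (simp add: s w y algebra_simps)
    finally have "x - \<delta> *\<^sub>R 1 + \<eta> *\<^sub>R (1 - \<delta> *\<^sub>R y) \<in> pos"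
      using pos_square[OF self_adjoint_commuting_mult[OF s(1) w(1)]] s(3) by simp
    \<comment> \<open>Adding \<open>\<eta> *\<^sub>R (1 + \<delta> *\<^sub>R y)\<close> cancels the
      \<open>y\<close> term, so that the total error is exactly \<open>e\<close>.\<close>
    moreover have "1 + \<delta> *\<^sub>R y \<in> pos"
      using n ysa by (auto simp: pos_def intro!: exI[of _ 1])
    then have "\<eta> *\<^sub>R (1 + \<delta> *\<^sub>R y) \<in> pos" using \<eta> by (intro pos_scaleR) auto
    ultimately have "x - \<delta> *\<^sub>R 1 + \<eta> *\<^sub>R (1 - \<delta> *\<^sub>R y) + \<eta> *\<^sub>R (1 + \<delta> *\<^sub>R y) \<in> pos"
      by (rule pos_add)
    then show "x - \<delta> *\<^sub>R 1 + e *\<^sub>R 1 \<in> pos" unfolding e\<eta> by (simp add: algebra_simps)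
  qed
  with \<delta> that show thesis by blast
qed

text \<open>Let \<open>T\<close> be the least nonnegative shift that makes \<open>a\<close>
  positive. If \<open>T > 0\<close>, invertibility of the shifted element leaves room to lower the
  shift further, so \<open>T = 0\<close>.\<close>

lemma pos_of_shift_invertible:
  assumes a: "a \<in> self_adjoint" and inv: "\<And>t. 0 < t \<Longrightarrow> invertible_elem (a + t *\<^sub>R 1)"
  shows "a \<in> pos"
proof -
  define S where "S = {t. 0 \<le> t \<and> a + t *\<^sub>R 1 \<in> pos}"
  define T where "T = Inf S"
  have "a + norm a *\<^sub>R 1 \<in> pos" using a by (auto simp: pos_def intro!: exI[of _ "norm a"])
  then have "norm a \<in> S" unfolding S_def using norm_ge_zero by blast
  have bdd: "bdd_below S" by (auto simp: S_def)
  have T0: "0 \<le> T" unfolding T_def using \<open>norm a \<in> S\<close> by (intro cInf_greatest) (blast, simp add: S_def)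
  have TS: "a + T *\<^sub>R 1 \<in> pos"
  proof (rule pos_closed)
    show "a + T *\<^sub>R 1 \<in> self_adjoint" using a by auto
    fix \<eta> :: real assume "0 < \<eta>"
    then obtain s where s: "s \<in> S" "s < T + \<eta>"
      unfolding T_def using cInf_lessD[of S "Inf S + \<eta>"] \<open>norm a \<in> S\<close> by auto
    then have "(a + s *\<^sub>R 1) + (T + \<eta> - s) *\<^sub>R 1 \<in> pos"
      by (intro pos_add[of "a + s *\<^sub>R 1"] pos_scaleR_one) (auto simp: S_def)
    then show "a + T *\<^sub>R 1 + \<eta> *\<^sub>R 1 \<in> pos" by (simp add: algebra_simps)
  qed
  have "T = 0"
  proof (rule ccontr)
    assume "T \<noteq> 0"
    then have "0 < T" using T0 by simp
    obtain \<delta> where \<delta>: "0 < \<delta>" "a + T *\<^sub>R 1 - \<delta> *\<^sub>R 1 \<in> pos"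
      using pos_invertible_lower_bound[OF TS inv[OF \<open>0 < T\<close>]] by blast
    \<comment> \<open>The minimum keeps the lowered shift \<open>T - \<mu>\<close> nonnegative, as
      \<open>S\<close> demands.\<close>
    define \<mu> where "\<mu> = min \<delta> T"
    have "a + T *\<^sub>R 1 - \<delta> *\<^sub>R 1 + (\<delta> - \<mu>) *\<^sub>R 1 \<in> pos"
      by (intro pos_add[OF \<delta>(2)] pos_scaleR_one) (simp add: \<mu>_def)
    then have "T - \<mu> \<in> S" by (simp add: S_def \<mu>_def algebra_simps)
    then have "T \<le> T - \<mu>" unfolding T_def using bdd by (rule cInf_lower)
    then show False using \<delta> \<open>0 < T\<close> by (simp add: \<mu>_def)
  qed
  with TS show ?thesis by simp
qed

text \<open>Conjugating with an invertible \<open>c\<close> turns \<open>c q c + t\<close> into \<open>q + t c\<^sup>-\<^sup>2\<close>, so the positivity of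
  general \<open>z\<^sup>* z\<close> is not needed.\<close>

lemma pos_conjugate:
  assumes q: "q \<in> pos" and c: "c \<in> self_adjoint" "invertible_elem c"
  shows "c * q * c \<in> pos"
proof (rule pos_of_shift_invertible)
  show "c * q * c \<in> self_adjoint" using c pos_self_adjoint[OF q] by auto
  fix t :: real assume t: "0 < t"
  obtain d where d: "c * d = 1" "d * c = 1" using c by (auto simp: invertible_elem_iff)
  have dsa: "d \<in> self_adjoint" using inverse_self_adjoint[OF d(1) c(1)] by simp
  have "invertible_elem d" using d by (auto simp: invertible_elem_iff)
  then have "invertible_elem (d * d)" by (intro invertible_elem_mult)
  then obtain \<delta> where \<delta>: "0 < \<delta>" "d * d - \<delta> *\<^sub>R 1 \<in> pos"
    using pos_invertible_lower_bound[OF pos_square[OF dsa]] by blast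
  have "q + t *\<^sub>R (d * d - \<delta> *\<^sub>R 1) \<in> pos"
    using t \<delta> q by (intro pos_add pos_scaleR) auto
  then have "q + t *\<^sub>R (d * d) - (t * \<delta>) *\<^sub>R 1 \<in> pos" by (simp add: algebra_simps)
  then have "invertible_elem (q + t *\<^sub>R (d * d))"
    by (rule invertible_of_pos_diff) (use t \<delta> in auto)
  then have "invertible_elem (c * (q + t *\<^sub>R (d * d)) * c)"
    using c by (intro invertible_elem_mult)
  moreover have "c * (d * d) * c = 1" by (metis d mult.assoc mult_1_left)
  then have "c * (q + t *\<^sub>R (d * d)) * c = c * q * c + t *\<^sub>R 1"
    by (simp add: distrib_left distrib_right)
  ultimately show "invertible_elem (c * q * c + t *\<^sub>R 1)" by simp
qed

text \<open>Here \<open>u\<close> is the inverse of \<open>r\<close>, so \<open>u * p * u\<close>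
  and \<open>u * q * u\<close> are positive with sum 1.\<close>

lemma norm_conjugate_inverse_sqrt_le:
  assumes "p \<in> pos" "q \<in> pos" and r: "r \<in> self_adjoint" "r * r = p + q" "r * u = 1"
  shows "norm (u * p * u) \<le> 1"
proof -
  note u = inverse_self_adjoint[OF r(3,1)]
  have "invertible_elem u" using u r by (auto simp: invertible_elem_iff)
  then have "u * p * u \<in> pos" "u * q * u \<in> pos" using assms u by (auto intro: pos_conjugate)
  moreover have "u * (r * r) * u = 1" by (metis r(3) u(2) mult.assoc mult_1_left)
  then have "1 *\<^sub>R 1 - u * p * u = u * q * u" by (simp add: r(2) algebra_simps)
  ultimately show ?thesis by (intro norm_le_of_pos) auto
qed

text \<open>\<open>u\<close> is \<open>(x + t)\<^sup>-\<^sup>1\<^sup>/\<^sup>2\<close> for \<open>x = \<Sum>b\<^sub>k\<^sup>2\<close>.\<close>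

lemma inverse_sqrt_sum_squares:
  fixes b :: "'i \<Rightarrow> 'a::{cstar_algebra,monoid_mult}"
  assumes I: "finite I" and b: "\<And>k. k \<in> I \<Longrightarrow> b k \<in> self_adjoint" and t: "0 < t"
  obtains u where "u \<in> self_adjoint" "u * u * ((\<Sum>k\<in>I. b k * b k) + t *\<^sub>R 1) = 1"
    "((\<Sum>k\<in>I. b k * b k) + t *\<^sub>R 1) * (u * u) = 1"
    "\<And>k. k \<in> I \<Longrightarrow> norm (b k * u) \<le> 1" "sqrt t * norm u \<le> 1"
    "norm ((\<Sum>k\<in>I. b k * b k) * (u * u)) \<le> 1"
proof -
  define x where "x = (\<Sum>k\<in>I. b k * b k)"
  have x: "x \<in> pos" unfolding x_def using b by (intro pos_sum pos_square)
  obtain r where r: "r \<in> self_adjoint" "r * r = x + t *\<^sub>R 1" "x * r = r * x"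
    using pos_sqrt[OF x t] by metis
  have "invertible_elem (x + t *\<^sub>R 1)"
    by (rule invertible_of_pos_diff[of _ t]) (use x t in auto)
  then obtain v where v: "(x + t *\<^sub>R 1) * v = 1" by (auto simp: invertible_elem_iff)
  define u where "u = r * v"
  have ru: "r * u = 1" using v by (simp add: u_def r(2) flip: mult.assoc)
  note u = inverse_self_adjoint[OF ru r(1)]
  have uu: "u * u * (x + t *\<^sub>R 1) = 1" "(x + t *\<^sub>R 1) * (u * u) = 1"
    unfolding r(2)[symmetric] by (simp_all add: mult_cancel_inner ru u(2))
  \<comment> \<open>\<open>r * r\<close> splits into \<open>b k * b k\<close> and a positive rest.
    The C*-identity turns the bound on \<open>u * (b k * b k) * u\<close> into one on
    \<open>b k * u\<close>.\<close>
  have bu: "norm (b k * u) \<le> 1" if k: "k \<in> I" for k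
  proof -
    have "x = b k * b k + (\<Sum>k\<in>I - {k}. b k * b k)" unfolding x_def by (rule sum.remove[OF I k])
    then have "r * r = b k * b k + ((\<Sum>k\<in>I - {k}. b k * b k) + t *\<^sub>R 1)" by (simp add: r(2) add.assoc)
    moreover have "(\<Sum>k\<in>I - {k}. b k * b k) + t *\<^sub>R 1 \<in> pos"
      using b t by (intro pos_add pos_sum pos_square pos_scaleR_one) auto
    ultimately have "norm (u * (b k * b k) * u) \<le> 1"
      using pos_square[OF b[OF k]] r(1) ru by (intro norm_conjugate_inverse_sqrt_le)
    moreover have "star (b k * u) * (b k * u) = u * (b k * b k) * u"
      using u(1) b[OF k] by (simp add: self_adjoint_def star_mult mult.assoc)
    ultimately have "(norm (b k * u))\<^sup>2 \<le> 1" using cstar_identity[of "b k * u"] by simp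
    then show ?thesis by (simp add: abs_square_le_1)
  qed
  have tu: "sqrt t * norm u \<le> 1"
  proof -
    have "norm (u * (t *\<^sub>R 1) * u) \<le> 1"
      by (rule norm_conjugate_inverse_sqrt_le[OF pos_scaleR_one x r(1) _ ru]) (use r t in auto)
    then have "t * norm (star u * u) \<le> 1" using u(1) t by (simp add: self_adjoint_def)
    then have "(sqrt t * norm u)\<^sup>2 \<le> 1" using t by (simp add: cstar_identity power_mult_distrib)
    then show ?thesis using t by (simp add: abs_square_le_1)
  qed
  have "norm (x * (u * u)) \<le> 1"
  proof -
    have "u * x = x * u" using inverse_commutes[OF ru u(2) r(3)] by simp
    then have "u * x * u = x * (u * u)" by (simp add: mult.assoc)
    then show ?thesis
      using norm_conjugate_inverse_sqrt_le[OF x pos_scaleR_one r(1,2) ru] t by simp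
  qed
  then show thesis using that[of u] u(1) uu bu tu unfolding x_def by blast
qed

text \<open>Quantitative injectivity of the map from \<open>\<xi>\<close> to the family of all
  \<open>b k * \<xi>\<close>. The test vectors are elements of the algebra itself, in place of
  Hilbert space vectors. A bound \<open>e\<close> instead of a maximum also covers empty
  \<open>I\<close>.\<close>

definition jointly_bounded_below :: "'i set \<Rightarrow> ('i \<Rightarrow> 'a::real_normed_algebra) \<Rightarrow> real \<Rightarrow> bool" where
  "jointly_bounded_below I b \<delta> \<longleftrightarrow>
    (\<forall>\<xi> e. (\<forall>k\<in>I. norm (b k * \<xi>) \<le> e) \<longrightarrow> 0 \<le> e \<longrightarrow> \<delta> * norm \<xi> \<le> e)"

text \<open>A left inverse \<open>y\<close> of the sum recovers \<open>\<xi>\<close> from the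
  elements \<open>b k * \<xi>\<close>.\<close>

lemma invertible_sum_squaresD:
  fixes b :: "'i \<Rightarrow> 'a::{cstar_algebra,monoid_mult}"
  assumes "invertible_elem (\<Sum>k\<in>I. b k * b k)"
  obtains \<delta> where "0 < \<delta>" "jointly_bounded_below I b \<delta>"
proof -
  let ?x = "\<Sum>k\<in>I. b k * b k"
  obtain y where y: "y * ?x = 1" using assms by (auto simp: invertible_elem_iff)
  define C where "C = norm y * (\<Sum>k\<in>I. norm (b k)) + 1"
  have C: "C > 0" unfolding C_def by (intro add_nonneg_pos mult_nonneg_nonneg sum_nonneg) auto
  have "inverse C * norm \<xi> \<le> e" if e: "\<forall>k\<in>I. norm (b k * \<xi>) \<le> e" "0 \<le> e" for \<xi> e
  proof -
    have "\<xi> = y * (\<Sum>k\<in>I. b k * (b k * \<xi>))"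
      using y by (simp flip: mult.assoc sum_distrib_right)
    then have "norm \<xi> \<le> norm y * norm (\<Sum>k\<in>I. b k * (b k * \<xi>))" by (metis norm_mult_ineq)
    also have "\<dots> \<le> norm y * (\<Sum>k\<in>I. norm (b k) * e)"
      by (intro mult_left_mono sum_norm_le order_trans[OF norm_mult_ineq mult_left_mono]) (use e in auto)
    also have "\<dots> \<le> C * e" using e(2) by (simp add: C_def distrib_right mult.assoc flip: sum_distrib_right)
    finally show ?thesis using C by (simp add: field_simps)
  qed
  then have "jointly_bounded_below I b (inverse C)" by (simp add: jointly_bounded_below_def)
  with C show thesis by (intro that[of "inverse C"]) auto
qed

text \<open>Testing the lower bound on \<open>u\<close>, a root of the inverse of
  \<open>?x + t *\<^sub>R 1\<close>, gives \<open>norm u \<le> 1 / \<delta>\<close>. For the chosen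
  \<open>t\<close>, the element \<open>t *\<^sub>R (u * u)\<close> then has norm at most
  \<open>1 / 2\<close>, and \<open>?x\<close> is \<open>?x + t *\<^sub>R 1\<close> times
  \<open>1 - t *\<^sub>R (u * u)\<close>.\<close>

lemma invertible_sum_squaresI:
  fixes b :: "'i \<Rightarrow> 'a::{cstar_algebra,monoid_mult}"
  assumes I: "finite I" and b: "\<And>k. k \<in> I \<Longrightarrow> b k \<in> self_adjoint" and "0 < \<delta>"
    and \<delta>: "jointly_bounded_below I b \<delta>"
  shows "invertible_elem (\<Sum>k\<in>I. b k * b k)" (is "invertible_elem ?x")
proof -
  define t where "t = \<delta>\<^sup>2 / 2"
  have t: "0 < t" using \<open>0 < \<delta>\<close> by (simp add: t_def)
  obtain u where u: "u \<in> self_adjoint" "u * u * (?x + t *\<^sub>R 1) = 1" "(?x + t *\<^sub>R 1) * (u * u) = 1"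
      "\<And>k. k \<in> I \<Longrightarrow> norm (b k * u) \<le> 1"
    by (rule inverse_sqrt_sum_squares[OF I b t]) blast+
  have "\<delta> * norm u \<le> 1" using \<delta> u by (simp add: jointly_bounded_below_def)
  then have "(\<delta> * norm u)\<^sup>2 \<le> 1" using \<open>0 < \<delta>\<close> by (simp add: abs_square_le_1)
  then have "t * norm (u * u) < 1"
    using mult_left_mono[OF norm_mult_ineq[of u u], of t] t by (simp add: t_def power_mult_distrib power2_eq_square algebra_simps)
  then have "invertible_elem (1 - t *\<^sub>R (u * u))" using t by (intro Neumann_invertible) simp
  moreover have "invertible_elem (?x + t *\<^sub>R 1)" using u by (auto simp: invertible_elem_iff)
  ultimately have "invertible_elem ((?x + t *\<^sub>R 1) * (1 - t *\<^sub>R (u * u)))" by (rule invertible_elem_mult[rotated])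
  moreover have "(?x + t *\<^sub>R 1) * (1 - t *\<^sub>R (u * u)) = ?x"
    using u(3) by (simp add: right_diff_distrib)
  ultimately show "invertible_elem ?x" by simp
qed

section \<open>Quasicentral approximate units\<close>

definition star_ideal :: "'a::star_ring set \<Rightarrow> bool" where
  "star_ideal J \<longleftrightarrow> 0 \<in> J \<and> (\<forall>x\<in>J. \<forall>y\<in>J. x + y \<in> J) \<and> (\<forall>x\<in>J. \<forall>z. z * x \<in> J \<and> x * z \<in> J)
    \<and> (\<forall>x\<in>J. star x \<in> J)"

lemma star_idealD:
  assumes "star_ideal J"
  shows "0 \<in> J" "x \<in> J \<Longrightarrow> y \<in> J \<Longrightarrow> x + y \<in> J" "x \<in> J \<Longrightarrow> z * x \<in> J"
    "x \<in> J \<Longrightarrow> x * z \<in> J" "x \<in> J \<Longrightarrow> star x \<in> J"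
  using assms by (auto simp: star_ideal_def)

lemma star_ideal_scaleR:
  assumes "star_ideal J" "x \<in> J"
  shows "r *\<^sub>R x \<in> (J :: 'a::{cstar_algebra,monoid_mult} set)"
  using star_idealD(3)[OF assms, of "r *\<^sub>R 1"] by simp

lemma star_ideal_diff:
  assumes "star_ideal J" "x \<in> J" "y \<in> J"
  shows "x - y \<in> (J :: 'a::{cstar_algebra,monoid_mult} set)"
  using star_idealD(2)[OF assms(1,2) star_ideal_scaleR[OF assms(1,3), of "-1"]] by simp

lemma star_ideal_sum:
  "star_ideal J \<Longrightarrow> (\<And>k. k \<in> I \<Longrightarrow> f k \<in> J) \<Longrightarrow> sum f I \<in> J"
  by (induction I rule: infinite_finite_induct) (auto simp: star_idealD)

lemma self_adjoint_mult_star: "x * star x \<in> self_adjoint"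
  by (simp add: self_adjoint_def star_mult)

text \<open>With \<open>x = \<Sum>(y y\<^sup>*)\<^sup>2\<close>, the element \<open>x (x + t)\<^sup>-\<^sup>1\<close> works for small \<open>t\<close>.\<close>

lemma approximate_unit:
  fixes J :: "'a::{cstar_algebra,monoid_mult} set"
  assumes J: "star_ideal J" and F: "finite F" "F \<subseteq> J" and \<eta>: "0 < \<eta>"
  obtains e where "e \<in> J" "e \<in> self_adjoint" "norm e \<le> 1" "norm (1 - e) \<le> 1"
    "\<And>y. y \<in> F \<Longrightarrow> norm ((1 - e) * y) \<le> \<eta>"
proof -
  \<comment> \<open>\<open>y * star y\<close> is self-adjoint, so that arbitrary members of
    \<open>F\<close> can enter a sum of squares.\<close>
  define g where "g y = y * star y" for y :: 'a
  have gsa: "g y \<in> self_adjoint" for y by (simp add: g_def self_adjoint_mult_star)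
  define x where "x = (\<Sum>y\<in>F. g y * g y)"
  \<comment> \<open>The square of \<open>norm ((1 - e) * y)\<close> will be bounded by
    \<open>sqrt t\<close>, which should equal \<open>\<eta>\<^sup>2\<close>.\<close>
  define t where "t = \<eta> ^ 4"
  have t: "0 < t" "sqrt t = \<eta>\<^sup>2" using \<eta> by (auto simp: t_def intro!: real_sqrt_unique)
  obtain u where u: "u \<in> self_adjoint" "u * u * (x + t *\<^sub>R 1) = 1" "(x + t *\<^sub>R 1) * (u * u) = 1"
    "\<And>y. y \<in> F \<Longrightarrow> norm (g y * u) \<le> 1" "sqrt t * norm u \<le> 1" "norm (x * (u * u)) \<le> 1"
    unfolding x_def by (rule inverse_sqrt_sum_squares[where b = g, OF F(1) gsa t(1)]) blast+
  define e where "e = x * (u * u)"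
  have xsa: "x \<in> self_adjoint" unfolding x_def by (intro self_adjoint_sum self_adjoint_intros gsa)
  have e1: "1 - e = t *\<^sub>R (u * u)" using u(3) by (simp add: e_def algebra_simps)
  have "x \<in> J" unfolding x_def g_def using F(2) by (intro star_ideal_sum[OF J] star_idealD(4)[OF J]) auto
  then have eJ: "e \<in> J" unfolding e_def by (rule star_idealD(4)[OF J])
  have "e = 1 - t *\<^sub>R (u * u)" using e1 by (simp add: algebra_simps)
  also have "\<dots> \<in> self_adjoint" using u(1) by (intro self_adjoint_intros) auto
  finally have esa: "e \<in> self_adjoint" .
  have tu: "(sqrt t * norm u)\<^sup>2 \<le> 1" using u(5) t by (simp add: abs_square_le_1)
  have "norm (1 - e) \<le> t * (norm u * norm u)"
    unfolding e1 using norm_mult_ineq[of u u] t by (simp add: mult_left_mono)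
  also have "\<dots> \<le> 1" using tu t(1) by (simp add: power_mult_distrib flip: power2_eq_square)
  finally have ne1: "norm (1 - e) \<le> 1" .
  have "norm ((1 - e) * y) \<le> \<eta>" if y: "y \<in> F" for y
  proof -
    have e1sa: "star (1 - e) = 1 - e" using esa by (simp add: self_adjoint_def star_diff)
    have "g y * (1 - e) = t *\<^sub>R (g y * u * u)" unfolding e1 by (simp add: mult.assoc)
    then have "norm (g y * (1 - e)) \<le> t * (norm (g y * u) * norm u)"
      using norm_mult_ineq[of "g y * u" u] t by (simp add: mult_left_mono)
    also have "\<dots> \<le> t * (1 * norm u)"
      using u(4)[OF y] t by (intro mult_left_mono mult_right_mono) auto
    also have "\<dots> = sqrt t * (sqrt t * norm u)" using t(1) by simp
    also have "\<dots> \<le> sqrt t * 1" using u(5) t(1) by (intro mult_left_mono) auto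
    finally have gy: "norm (g y * (1 - e)) \<le> \<eta>\<^sup>2" using t(2) by simp
    have "(norm ((1 - e) * y))\<^sup>2 = norm ((1 - e) * (g y * (1 - e)))"
      using cstar_identity'[of "(1 - e) * y"] by (simp add: g_def star_mult e1sa mult.assoc)
    also have "\<dots> \<le> 1 * \<eta>\<^sup>2"
      by (rule order_trans[OF norm_mult_ineq mult_mono]) (use ne1 gy in auto)
    finally show ?thesis using \<eta> by (simp add: abs_le_square_iff[symmetric])
  qed
  then show thesis using that eJ esa ne1 u(6) by (simp add: e_def)
qed

text \<open>The commutators of \<open>x\<close> with successive members of an approximate unit can be chosen almost
  orthogonal, so that the squared norm of their sum grows only linearly in the number \<open>N\<close> of
  summands.\<close>

lemma almost_orthogonal_commutators:
  fixes J :: "'a::{cstar_algebra,monoid_mult} set"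
  assumes J: "star_ideal J" and X: "finite X" "X \<subseteq> self_adjoint" "\<And>x. x \<in> X \<Longrightarrow> norm x \<le> K"
    and K: "0 \<le> K" and k: "k \<in> J" and \<eta>: "0 < \<eta>"
  shows "\<exists>H\<in>J. H \<in> self_adjoint \<and> norm H \<le> real N \<and> norm (real N *\<^sub>R 1 - H) \<le> real N
    \<and> norm (k * (real N *\<^sub>R 1 - H)) \<le> real N * \<eta>
    \<and> (\<forall>x\<in>X. (norm (x * H - H * x))\<^sup>2 \<le> real N * (4 * K\<^sup>2 + 1))"
proof (induction N)
  case 0
  show ?case using J by (intro bexI[of _ 0]) (auto simp: star_idealD)
next
  case (Suc N)
  then obtain H where H: "H \<in> J" "H \<in> self_adjoint" "norm H \<le> real N" "norm (real N *\<^sub>R 1 - H) \<le> real N"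
    "norm (k * (real N *\<^sub>R 1 - H)) \<le> real N * \<eta>"
    "\<And>x. x \<in> X \<Longrightarrow> (norm (x * H - H * x))\<^sup>2 \<le> real N * (4 * K\<^sup>2 + 1)" by blast
  define S where "S x = x * H - H * x" for x
  have SJ: "S x \<in> J" for x unfolding S_def using H(1) J by (intro star_ideal_diff) (auto simp: star_idealD)
  \<comment> \<open>The second bound makes each cross term, estimated by
    \<open>K * \<mu> + \<mu>\<close>, at most \<open>1 / 2\<close>.\<close>
  define \<mu> where "\<mu> = min \<eta> (1 / (2 * (K + 1)))"
  have \<mu>: "0 < \<mu>" "\<mu> \<le> \<eta>" "(K + 1) * \<mu> \<le> 1 / 2"
    using \<eta> K by (auto simp: \<mu>_def min_def field_simps)
  \<comment> \<open>The cross term involves both \<open>S x\<close> and \<open>x * S x\<close>. The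
    adjoint of \<open>k\<close> is listed because \<open>1 - e\<close> acts on \<open>F\<close> from
    the left but on \<open>k\<close> from the right.\<close>
  define F where "F = insert (star k) (S ` X \<union> (\<lambda>x. x * S x) ` X)"
  have F: "finite F" "F \<subseteq> J"
    unfolding F_def using X(1) SJ k J by (auto simp: star_idealD)
  obtain e where e: "e \<in> J" "e \<in> self_adjoint" "norm e \<le> 1" "norm (1 - e) \<le> 1"
    "\<And>y. y \<in> F \<Longrightarrow> norm ((1 - e) * y) \<le> \<mu>"
    using approximate_unit[OF J F \<mu>(1)] by blast
  have split: "real (Suc N) *\<^sub>R 1 - (H + e) = (real N *\<^sub>R 1 - H) + (1 - e)"
    by (simp add: algebra_simps)
  have "star ((1 - e) * star k) = k * (1 - e)"
    using e(2) by (simp add: self_adjoint_def star_mult star_diff)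
  then have ke: "norm (k * (1 - e)) \<le> \<eta>"
    using e(5)[of "star k"] \<mu>(2) norm_star[of "(1 - e) * star k"] by (simp add: F_def)
  have "(norm (x * (H + e) - (H + e) * x))\<^sup>2 \<le> real (Suc N) * (4 * K\<^sup>2 + 1)" if x: "x \<in> X" for x
  proof -
    define D where "D = (1 - e) * x - x * (1 - e)"
    have xs: "star x = x" and es: "star e = e" using x X(2) e(2) by (auto simp: self_adjoint_def)
    have nx: "norm x \<le> K" using X(3)[OF x] .
    have eq: "x * (H + e) - (H + e) * x = S x + D" by (simp add: S_def D_def algebra_simps)
    have "norm D \<le> norm (1 - e) * norm x + norm x * norm (1 - e)"
      unfolding D_def by (rule order_trans[OF norm_triangle_ineq4 add_mono[OF norm_mult_ineq norm_mult_ineq]])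
    also have "\<dots> \<le> 1 * K + K * 1" using nx e(4) K by (intro add_mono mult_mono) auto
    finally have "norm D \<le> 2 * K" by simp
    then have nD: "(norm D)\<^sup>2 \<le> 4 * K\<^sup>2" using power_mono[of "norm D" "2 * K" 2] by (simp add: power_mult_distrib)
    have "star D * S x = x * ((1 - e) * S x) - (1 - e) * (x * S x)"
      by (simp add: D_def star_diff star_mult xs es algebra_simps)
    also have "norm \<dots> \<le> norm x * norm ((1 - e) * S x) + norm ((1 - e) * (x * S x))"
      by (rule order_trans[OF norm_triangle_ineq4 add_right_mono[OF norm_mult_ineq]])
    also have "\<dots> \<le> K * \<mu> + \<mu>"
      using x nx K by (intro add_mono mult_mono e(5)) (auto simp: F_def)
    finally have DS: "norm (star D * S x) \<le> 1 / 2" using \<mu>(3) by (simp add: algebra_simps)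
    have "star (star D * S x) = star (S x) * D" by (simp add: star_mult)
    then have SD: "norm (star (S x) * D) \<le> 1 / 2" using DS norm_star[of "star D * S x"] by simp
    \<comment> \<open>In the expanded square the two cross terms add at most 1 and \<open>D\<close>
      adds at most \<open>4 * K\<^sup>2\<close>, which is the growth allowed per step.\<close>
    have "star (S x + D) * (S x + D) = star (S x) * S x + star (S x) * D + (star D * S x + star D * D)"
      by (simp add: star_add algebra_simps)
    then have "(norm (S x + D))\<^sup>2 \<le> (norm (S x))\<^sup>2 + norm (star (S x) * D) + (norm (star D * S x) + (norm D)\<^sup>2)"
      unfolding cstar_identity[symmetric] by (simp only:) (intro norm_triangle_mono order_refl)
    also have "\<dots> \<le> real N * (4 * K\<^sup>2 + 1) + 1 / 2 + (1 / 2 + 4 * K\<^sup>2)"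
      using H(6)[OF x] nD SD DS by (intro add_mono) (auto simp: S_def)
    finally show ?thesis unfolding eq by (simp add: algebra_simps)
  qed
  moreover have "norm (H + e) \<le> real (Suc N)"
    using norm_triangle_mono[OF H(3) e(3)] by simp
  moreover have "norm (real (Suc N) *\<^sub>R 1 - (H + e)) \<le> real (Suc N)"
    unfolding split using norm_triangle_mono[OF H(4) e(4)] by simp
  moreover have "norm (k * (real (Suc N) *\<^sub>R 1 - (H + e))) \<le> real (Suc N) * \<eta>"
    unfolding split using norm_triangle_mono[OF H(5) ke] by (simp add: algebra_simps)
  moreover have "H + e \<in> J" "H + e \<in> self_adjoint" using H e J by (auto simp: star_idealD)
  ultimately show ?case by blast
qed

text \<open>Dividing the sum of \<open>N\<close> approximate unit elements by \<open>N\<close>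
  leaves commutators of norm at most \<open>sqrt ((4 * K\<^sup>2 + 1) / N)\<close>, which is below
  \<open>\<eta>\<close> for large \<open>N\<close>.\<close>

lemma quasicentral_unit:
  fixes J :: "'a::{cstar_algebra,monoid_mult} set"
  assumes J: "star_ideal J" and X: "finite X" "X \<subseteq> self_adjoint" and k: "k \<in> J" and \<eta>: "0 < \<eta>"
  obtains h where "h \<in> J" "h \<in> self_adjoint" "norm h \<le> 1" "norm (1 - h) \<le> 1"
    "norm (k * (1 - h)) \<le> \<eta>" "\<And>x. x \<in> X \<Longrightarrow> norm (x * h - h * x) \<le> \<eta>"
proof -
  define K where "K = (\<Sum>x\<in>X. norm x)"
  have K: "0 \<le> K" "\<And>x. x \<in> X \<Longrightarrow> norm x \<le> K"
    unfolding K_def using X(1) by (auto intro: sum_nonneg member_le_sum)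
  obtain N :: nat where N: "(4 * K\<^sup>2 + 1) / \<eta>\<^sup>2 < real N" using reals_Archimedean2 by blast
  have "0 < (4 * K\<^sup>2 + 1) / \<eta>\<^sup>2" using \<eta> by (intro divide_pos_pos add_nonneg_pos) auto
  then have N0: "0 < real N" using N by linarith
  have N2: "4 * K\<^sup>2 + 1 \<le> real N * \<eta>\<^sup>2" using N \<eta> by (simp add: field_simps)
  obtain H where H: "H \<in> J" "H \<in> self_adjoint" "norm H \<le> real N" "norm (real N *\<^sub>R 1 - H) \<le> real N"
    "norm (k * (real N *\<^sub>R 1 - H)) \<le> real N * \<eta>"
    "\<And>x. x \<in> X \<Longrightarrow> (norm (x * H - H * x))\<^sup>2 \<le> real N * (4 * K\<^sup>2 + 1)"
    using almost_orthogonal_commutators[OF J X K(2,1) k \<eta>, of N] by blast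
  define h where "h = inverse (real N) *\<^sub>R H"
  have h1: "1 - h = inverse (real N) *\<^sub>R (real N *\<^sub>R 1 - H)" using N0 by (simp add: h_def algebra_simps)
  have sc: "norm (inverse (real N) *\<^sub>R z) \<le> c" if "norm z \<le> real N * c" for z :: 'a and c
    using that N0 by (simp add: field_simps)
  have "norm (x * h - h * x) \<le> \<eta>" if x: "x \<in> X" for x
  proof -
    have "(norm (x * H - H * x))\<^sup>2 \<le> real N * (real N * \<eta>\<^sup>2)"
      using H(6)[OF x] mult_left_mono[OF N2, of "real N"] by simp
    then have "(norm (x * H - H * x))\<^sup>2 \<le> (real N * \<eta>)\<^sup>2" by (simp add: power2_eq_square mult_ac)
    then have "norm (x * H - H * x) \<le> real N * \<eta>" by (rule power2_le_imp_le) (use \<eta> in auto)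
    then have "norm (inverse (real N) *\<^sub>R (x * H - H * x)) \<le> \<eta>" by (rule sc)
    then show ?thesis by (simp add: h_def algebra_simps)
  qed
  moreover have "norm h \<le> 1" unfolding h_def using H(3) by (intro sc) simp
  moreover have "norm (1 - h) \<le> 1" unfolding h1 using H(4) by (intro sc) simp
  moreover have "norm (k * (1 - h)) \<le> \<eta>"
    unfolding h1 mult_scaleR_right using H(5) by (intro sc) simp
  moreover have "h \<in> J" "h \<in> self_adjoint" unfolding h_def using H J by (auto simp: star_ideal_scaleR)
  ultimately show thesis using that by blast
qed

section \<open>Lifting tuples from a quotient\<close>

lemma norm_mult_mono:
  fixes x y :: "'a::real_normed_algebra"
  shows "norm x \<le> a \<Longrightarrow> norm y \<le> b \<Longrightarrow> norm (x * y) \<le> a * b"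
  by (rule order_trans[OF norm_mult_ineq mult_mono]) (auto intro: order_trans[OF norm_ge_zero])

lemma norm_diff_mono:
  fixes x y :: "'a::real_normed_vector"
  shows "norm x \<le> a \<Longrightarrow> norm y \<le> b \<Longrightarrow> norm (x - y) \<le> a + b"
  by (rule order_trans[OF norm_triangle_ineq4 add_mono])

text \<open>The admissible size of \<open>\<epsilon>\<close> depends on \<open>a\<close> and
  \<open>y\<close> alone, where \<open>y\<close> is a left inverse modulo \<open>J\<close>. Only
  \<open>h\<close> is chosen after \<open>c\<close>, with a precision depending on the lower bound
  \<open>\<delta>\<close> of \<open>c\<close>.\<close>

lemma lift_invertible_sum_squares:
  fixes J :: "'a::{cstar_algebra,monoid_mult} set"
  assumes J: "star_ideal J" and I: "finite I"
    and a: "\<And>k. k \<in> I \<Longrightarrow> a k \<in> self_adjoint" and c: "\<And>k. k \<in> I \<Longrightarrow> c k \<in> self_adjoint"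
    and y: "y * (\<Sum>k\<in>I. a k * a k) - 1 \<in> J"
    and inv: "invertible_elem (\<Sum>k\<in>I. c k * c k)"
    and \<epsilon>: "0 \<le> \<epsilon>" "\<And>k. k \<in> I \<Longrightarrow> norm (c k - a k) \<le> \<epsilon>" "\<epsilon> * (norm y * (\<Sum>k\<in>I. norm (a k))) \<le> 1 / 2"
  obtains b where "\<And>k. k \<in> I \<Longrightarrow> b k \<in> self_adjoint" "\<And>k. k \<in> I \<Longrightarrow> b k - a k \<in> J"
    "\<And>k. k \<in> I \<Longrightarrow> norm (b k - a k) \<le> \<epsilon>" "invertible_elem (\<Sum>k\<in>I. b k * b k)"
proof -
  define L where "L = norm y * (\<Sum>k\<in>I. norm (a k))"
  have L: "0 \<le> L" "\<epsilon> * L \<le> 1 / 2" using \<epsilon>(3) by (auto simp: L_def sum_nonneg)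
  define q where "q = y * (\<Sum>k\<in>I. a k * a k) - 1"
  define d where "d k = c k - a k" for k
  have d: "d k \<in> self_adjoint" if "k \<in> I" for k unfolding d_def using a c that by auto
  have nd: "norm (d k) \<le> \<epsilon>" if "k \<in> I" for k using \<epsilon>(2)[OF that] by (simp add: d_def)
  obtain \<delta> where \<delta>: "0 < \<delta>" "jointly_bounded_below I c \<delta>"
    using invertible_sum_squaresD[OF inv] .
  \<comment> \<open>The errors below add up to
    \<open>\<eta> * (4 + 2 * \<epsilon>) * norm \<xi>\<close>, which takes half of
    \<open>\<delta>\<close>.\<close>
  define \<eta> where "\<eta> = \<delta> / (2 * (4 + 2 * \<epsilon>))"
  have \<eta>: "0 < \<eta>" "\<eta> * (4 + 2 * \<epsilon>) = \<delta> / 2" using \<delta>(1) \<epsilon>(1) by (auto simp: \<eta>_def field_simps)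
  obtain h where h: "h \<in> J" "h \<in> self_adjoint" "norm h \<le> 1" "norm (1 - h) \<le> 1" "norm (q * (1 - h)) \<le> \<eta>"
    "\<And>x. x \<in> a ` I \<union> d ` I \<Longrightarrow> norm (x * h - h * x) \<le> \<eta>"
    by (rule quasicentral_unit[OF J _ _ _ \<eta>(1), of "a ` I \<union> d ` I" q]) (use I a d y in \<open>auto simp: q_def\<close>)
  \<comment> \<open>The symmetrised product keeps \<open>b k\<close> self-adjoint and differs from
    \<open>d k * h\<close> only by half a commutator, called \<open>E k\<close> below.\<close>
  define b where "b k = a k + (1/2) *\<^sub>R (h * d k + d k * h)" for k
  have b: "b k \<in> self_adjoint" if "k \<in> I" for k
    using a[OF that] d[OF that] h(2)
    by (auto simp: b_def self_adjoint_def star_add star_scaleR star_mult add.commute)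
  have hJ: "b k - a k \<in> J" for k
    unfolding b_def using star_idealD[OF J] h(1) by (auto intro!: star_ideal_scaleR[OF J])
  have nb: "norm (b k - a k) \<le> \<epsilon>" if "k \<in> I" for k
  proof -
    have "norm (h * d k) \<le> 1 * \<epsilon>" "norm (d k * h) \<le> \<epsilon> * 1"
      by (intro norm_mult_mono h nd that)+
    from norm_triangle_mono[OF this] show ?thesis by (simp add: b_def)
  qed
  have "\<delta> / 4 * norm \<xi> \<le> e" if e: "\<forall>k\<in>I. norm (b k * \<xi>) \<le> e" "0 \<le> e" for \<xi> e
  proof -
    define \<zeta> where "\<zeta> = (1 - h) * \<xi>"
    define E where "E k = (1/2) *\<^sub>R (h * d k - d k * h)" for k
    have E: "norm (E k) \<le> \<eta>" if "k \<in> I" for k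
      using h(6)[of "d k"] that \<eta>(1) by (simp add: E_def norm_minus_commute)
    have bE: "b k = a k + d k * h + E k" for k
      by (simp add: b_def E_def algebra_simps) (simp flip: scaleR_add_left)
    have a\<zeta>: "norm (a k * \<zeta>) \<le> e + 3 * \<eta> * norm \<xi> + \<epsilon> * norm \<zeta>" if k: "k \<in> I" for k
    proof -
      \<comment> \<open>Multiply \<open>b k * \<xi>\<close> by \<open>1 - h\<close> and move this
        factor to the right past \<open>a k\<close> and \<open>d k\<close>; the commutators that
        arise are small.\<close>
      have "a k * \<zeta> = (1 - h) * (b k * \<xi>) - (a k * h - h * a k) * \<xi> - d k * (h * \<zeta>)
          - (d k * h - h * d k) * (h * \<xi>) - (1 - h) * (E k * \<xi>)"
        by (simp add: \<zeta>_def bE algebra_simps)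
      also have "norm \<dots> \<le> 1 * e + \<eta> * norm \<xi> + \<epsilon> * (1 * norm \<zeta>) + \<eta> * (1 * norm \<xi>) + 1 * (\<eta> * norm \<xi>)"
        using e k by (intro norm_diff_mono norm_mult_mono h(3,4,6) nd E order_refl) auto
      finally show ?thesis by (simp add: algebra_simps)
    qed
    have "q * (1 - h) * \<xi> = q * \<zeta>" by (simp add: \<zeta>_def mult.assoc)
    \<comment> \<open>\<open>y\<close> inverts the sum of squares up to \<open>q\<close>, and
      \<open>q * (1 - h)\<close> is small.\<close>
    then have "\<zeta> = y * (\<Sum>k\<in>I. a k * (a k * \<zeta>)) - q * (1 - h) * \<xi>"
      by (simp add: q_def left_diff_distrib sum_distrib_right mult.assoc)
    also have "norm \<dots> \<le> norm y * (\<Sum>k\<in>I. norm (a k) * (e + 3 * \<eta> * norm \<xi> + \<epsilon> * norm \<zeta>)) + \<eta> * norm \<xi>"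
      by (intro norm_diff_mono norm_mult_mono sum_norm_le h(5) a\<zeta> order_refl)
    also have "\<dots> = L * (e + 3 * \<eta> * norm \<xi> + \<epsilon> * norm \<zeta>) + \<eta> * norm \<xi>"
      by (simp add: L_def sum_distrib_right)
    finally have "norm \<zeta> \<le> L * (e + 3 * \<eta> * norm \<xi>) + (\<epsilon> * L) * norm \<zeta> + \<eta> * norm \<xi>"
      by (simp add: algebra_simps)
    \<comment> \<open>This term is absorbed into the left-hand side.\<close>
    moreover have "(\<epsilon> * L) * norm \<zeta> \<le> 1 / 2 * norm \<zeta>" using L by (intro mult_right_mono) auto
    ultimately have "norm \<zeta> \<le> 2 * (L * (e + 3 * \<eta> * norm \<xi>) + \<eta> * norm \<xi>)" by simp
    then have "\<epsilon> * norm \<zeta> \<le> \<epsilon> * (2 * (L * (e + 3 * \<eta> * norm \<xi>) + \<eta> * norm \<xi>))"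
      using \<epsilon>(1) by (rule mult_left_mono)
    also have "\<dots> = 2 * ((\<epsilon> * L) * (e + 3 * \<eta> * norm \<xi>)) + 2 * \<epsilon> * \<eta> * norm \<xi>" by (simp add: algebra_simps)
    also have "\<dots> \<le> 2 * (1 / 2 * (e + 3 * \<eta> * norm \<xi>)) + 2 * \<epsilon> * \<eta> * norm \<xi>"
      using L e \<eta> by (intro add_right_mono mult_left_mono mult_right_mono) auto
    finally have \<epsilon>\<zeta>: "\<epsilon> * norm \<zeta> \<le> e + 3 * \<eta> * norm \<xi> + 2 * \<epsilon> * \<eta> * norm \<xi>"
      by (simp add: field_simps)
    have "norm (c k * \<xi>) \<le> e + \<epsilon> * norm \<zeta> + \<eta> * norm \<xi>" if k: "k \<in> I" for k
    proof -
      have "c k * \<xi> = b k * \<xi> + d k * \<zeta> - E k * \<xi>" by (simp add: bE \<zeta>_def algebra_simps) (simp add: d_def algebra_simps)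
      also have "norm \<dots> \<le> e + \<epsilon> * norm \<zeta> + \<eta> * norm \<xi>"
        using e k by (intro norm_diff_mono norm_triangle_mono norm_mult_mono[OF nd] norm_mult_mono[OF E] order_refl) auto
      finally show ?thesis .
    qed
    then have "\<delta> * norm \<xi> \<le> e + \<epsilon> * norm \<zeta> + \<eta> * norm \<xi>"
      using \<delta>(2) e \<epsilon>(1) \<eta>(1) by (simp add: jointly_bounded_below_def)
    also have "\<dots> \<le> 2 * e + \<eta> * (4 + 2 * \<epsilon>) * norm \<xi>" using \<epsilon>\<zeta> by (simp add: algebra_simps)
    finally show ?thesis unfolding \<eta>(2) by simp
  qed
  then have "invertible_elem (\<Sum>k\<in>I. b k * b k)"
    using \<delta>(1) by (intro invertible_sum_squaresI[of _ _ "\<delta> / 4"] I b) (auto simp: jointly_bounded_below_def)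
  with that b hJ nb show thesis by blast
qed

section \<open>Passing to longer tuples\<close>

lemma Lg_extend:
  fixes b :: "nat \<Rightarrow> 'a::{cstar_algebra,monoid_mult}"
  assumes b: "b \<in> {..<m} \<rightarrow>\<^sub>E self_adjoint" and c: "restrict b {..<n} \<in> Lg n" and nm: "n \<le> m"
  shows "b \<in> Lg m"
proof -
  have sa: "b k \<in> self_adjoint" if "k < m" for k using b that by (auto simp: PiE_iff)
  have "invertible_elem (\<Sum>k<n. b k * b k)" using c by (simp add: Lg_def)
  then obtain \<delta> where \<delta>: "0 < \<delta>" "jointly_bounded_below {..<n} b \<delta>"
    by (rule invertible_sum_squaresD)
  \<comment> \<open>Further entries only add premises to the lower bound, so it persists.\<close>
  then have "jointly_bounded_below {..<m} b \<delta>"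
    using nm by (auto simp: jointly_bounded_below_def)
  then have "invertible_elem (\<Sum>k<m. b k * b k)"
    using \<delta>(1) sa by (intro invertible_sum_squaresI) auto
  with b show ?thesis by (simp add: Lg_def)
qed

text \<open>The extension real rank asks for all larger lengths as well. Only the first
  \<open>n\<close> entries are perturbed, the others are kept.\<close>

lemma Lg_dense_mono:
  assumes "Lg_dense TYPE('a::{cstar_algebra,monoid_mult}) n" "n \<le> m"
  shows "Lg_dense TYPE('a) m"
  unfolding Lg_dense_iff
proof (intro ballI allI impI)
  fix a :: "nat \<Rightarrow> 'a" and \<epsilon> :: real
  assume a: "a \<in> {..<m} \<rightarrow>\<^sub>E self_adjoint" and \<epsilon>: "0 < \<epsilon>"
  have "restrict a {..<n} \<in> {..<n} \<rightarrow>\<^sub>E self_adjoint" using a assms(2) by (auto simp: PiE_iff)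
  then obtain c where c: "c \<in> Lg n" "\<And>k. k < n \<Longrightarrow> norm (a k - c k) < \<epsilon>"
    using assms(1) \<epsilon> unfolding Lg_dense_iff by fastforce
  define b where "b = (\<lambda>k\<in>{..<m}. if k < n then c k else a k)"
  have "restrict b {..<n} = c"
    using c(1) assms(2) by (auto simp: b_def Lg_def PiE_iff extensional_def fun_eq_iff)
  moreover have "b \<in> {..<m} \<rightarrow>\<^sub>E self_adjoint"
    using a c(1) by (auto simp: b_def PiE_iff Lg_def)
  ultimately have "b \<in> Lg m" using c(1) assms(2) Lg_extend[of b m n] by simp
  moreover have "norm (a k - b k) < \<epsilon>" if "k < m" for k using that c(2) \<epsilon> by (simp add: b_def)
  ultimately show "\<exists>b\<in>Lg m. \<forall>k<m. norm (a k - b k) < \<epsilon>" by blast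
qed

section \<open>The multiplier algebra and the unitization\<close>

lemma is_unit_elem_unique: "is_unit_elem e \<Longrightarrow> is_unit_elem f \<Longrightarrow> e = f"
  unfolding is_unit_elem_def by metis

lemma is_unit_elem_corona_one: "is_unit_elem (corona_proj 1)"
  unfolding is_unit_elem_def
proof
  fix x :: "'a corona"
  obtain y where "x = corona_proj y" by (rule corona_proj_cases)
  then show "corona_proj 1 * x = x \<and> x * corona_proj 1 = x"
    by (simp flip: corona_proj_simps)
qed

lemma corona_proj_sum: "corona_proj (sum f I) = (\<Sum>k\<in>I. corona_proj (f k))"
  by (induction I rule: infinite_finite_induct) (simp_all add: corona_proj_simps)

lemma corona_proj_sum_squares:
  "(\<Sum>k<n. (\<lambda>j\<in>{..<n}. corona_proj (a j)) k * (\<lambda>j\<in>{..<n}. corona_proj (a j)) k) =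
    corona_proj (\<Sum>k<n. a k * a k)"
  by (simp add: corona_proj_sum corona_proj_simps)

lemma to_multiplier_sum: "to_multiplier (sum f I) = (\<Sum>k\<in>I. to_multiplier (f k))"
  by (induction I rule: infinite_finite_induct) (simp_all add: to_multiplier_simps)

lemma to_multiplier_eq_iff [simp]: "to_multiplier a = to_multiplier b \<longleftrightarrow> a = b"
proof
  assume "to_multiplier a = to_multiplier b"
  then have "norm (to_multiplier (a - b)) = 0" by (simp add: to_multiplier_simps)
  then show "a = b" by simp
qed simp

lemma star_ideal_range_to_multiplier: "star_ideal (range to_multiplier)"
  unfolding star_ideal_def
  by (auto simp: to_multiplier_ideal simp flip: to_multiplier_simps)

text \<open>A left inverse in the quotient lifts to \<open>y\<close> with \<open>y * x - 1\<close>
  in \<open>A\<close>. Density is used with a tolerance fixed by \<open>a\<close>, \<open>y\<close>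
  and \<open>\<epsilon>\<close>, and the approximating tuple is then corrected to agree with
  \<open>a\<close> modulo \<open>A\<close>.\<close>

lemma property_Lambda_of_Lg_dense:
  assumes dense: "Lg_dense TYPE('a::cstar_algebra multiplier) (Suc n)"
  shows "property_Lambda TYPE('a) n"
  unfolding property_Lambda_def
proof (intro ballI impI allI)
  fix a :: "nat \<Rightarrow> 'a multiplier" and \<epsilon> :: real
  assume a: "a \<in> {..<Suc n} \<rightarrow>\<^sub>E self_adjoint" and \<epsilon>: "0 < \<epsilon>"
    and Lg: "(\<lambda>j\<in>{..<Suc n}. corona_proj (a j)) \<in> Lg (Suc n)"
  define x where "x = (\<Sum>k<Suc n. a k * a k)"
  have "invertible_elem (corona_proj x)"
    using Lg unfolding Lg_def mem_Collect_eq corona_proj_sum_squares x_def by simp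
  then obtain z where "is_unit_elem (z * corona_proj x)" by (auto simp: invertible_elem_def)
  moreover obtain y where "z = corona_proj y" by (rule corona_proj_cases)
  ultimately have "corona_proj (y * x) = corona_proj 1"
    using is_unit_elem_unique[OF _ is_unit_elem_corona_one] by (simp add: corona_proj_simps)
  then have y: "y * x - 1 \<in> range to_multiplier" by (simp add: corona_proj_eq_iff)
  define L where "L = norm y * (\<Sum>k<Suc n. norm (a k))"
  have L: "0 \<le> L" unfolding L_def by (intro mult_nonneg_nonneg sum_nonneg) auto
  \<comment> \<open>\<open>L + 1\<close> guards against \<open>L = 0\<close>, and
    \<open>\<epsilon> / 2\<close> turns the weak bound by \<open>\<mu>\<close> into a strict
    one.\<close>
  define \<mu> where "\<mu> = min (\<epsilon> / 2) (1 / (2 * (L + 1)))"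
  have "\<mu> * L \<le> 1 / (2 * (L + 1)) * L" using L by (intro mult_right_mono) (auto simp: \<mu>_def)
  also have "\<dots> \<le> 1 / 2" using L by (simp add: field_simps)
  finally have \<mu>: "0 < \<mu>" "\<mu> < \<epsilon>" "\<mu> * L \<le> 1 / 2" using \<epsilon> L by (auto simp: \<mu>_def)
  obtain c where c: "c \<in> Lg (Suc n)" "\<And>k. k < Suc n \<Longrightarrow> norm (a k - c k) < \<mu>"
    using dense a \<mu>(1) unfolding Lg_dense_iff by blast
  obtain b where b: "\<And>k. k \<in> {..<Suc n} \<Longrightarrow> b k \<in> self_adjoint"
    "\<And>k. k \<in> {..<Suc n} \<Longrightarrow> b k - a k \<in> range to_multiplier"
    "\<And>k. k \<in> {..<Suc n} \<Longrightarrow> norm (b k - a k) \<le> \<mu>" "invertible_elem (\<Sum>k<Suc n. b k * b k)"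
  proof (rule lift_invertible_sum_squares[where I = "{..<Suc n}" and a = a and c = c,
        OF star_ideal_range_to_multiplier])
    show "y * (\<Sum>k<Suc n. a k * a k) - 1 \<in> range to_multiplier" using y by (simp add: x_def)
    show "norm (c k - a k) \<le> \<mu>" if "k \<in> {..<Suc n}" for k
      using c(2)[of k] that by (simp add: norm_minus_commute)
    show "\<mu> * (norm y * (\<Sum>k<Suc n. norm (a k))) \<le> 1 / 2" using \<mu>(3) by (simp add: L_def)
  qed (use a c(1) \<mu>(1) in \<open>auto simp: PiE_iff Lg_def\<close>)
  have "restrict b {..<Suc n} \<in> Lg (Suc n)" using b(1,4) by (simp add: Lg_def)
  moreover have "corona_proj (a j) = corona_proj (b j)" if "j < Suc n" for j
    using b(2)[of j] that corona_proj_eq_iff[of "b j" "a j"] by simp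
  moreover have "norm (a j - b j) < \<epsilon>" if "j < Suc n" for j
    using b(3)[of j] that \<mu>(2) by (simp add: norm_minus_commute)
  ultimately show "\<exists>b\<in>Lg (Suc n). \<forall>j<Suc n. norm (a j - b j) < \<epsilon> \<and> corona_proj (a j) = corona_proj (b j)"
    by (intro bexI[of _ "restrict b {..<Suc n}"]) auto
qed

text \<open>A unit of \<open>A\<close> makes \<open>to_multiplier\<close> surjective. The quotient
  is then the zero ring, where every tuple qualifies, and the property becomes density in
  \<open>M(A) = A\<close>.\<close>

lemma Lg_dense_of_property_Lambda_unital:
  assumes \<Lambda>: "property_Lambda TYPE('a::cstar_algebra) n" and unital: "unital TYPE('a)"
  shows "Lg_dense TYPE('a) (Suc n)"
  unfolding Lg_dense_iff
proof (intro ballI allI impI)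
  fix a :: "nat \<Rightarrow> 'a" and \<epsilon> :: real
  assume a: "a \<in> {..<Suc n} \<rightarrow>\<^sub>E self_adjoint" and \<epsilon>: "0 < \<epsilon>"
  obtain e :: 'a where e: "is_unit_elem e" using unital by (auto simp: unital_def)
  have "to_multiplier e = 1"
    by (rule multiplier_eqI) (use e in \<open>simp_all add: is_unit_elem_def\<close>)
  then have surj: "x = to_multiplier (left_mult x e)" for x
    using to_multiplier_ideal(1)[of x e] by simp
  then have range: "x \<in> range to_multiplier" for x :: "'a multiplier" by blast
  have trivial: "x = y" for x y :: "'a corona"
    by (metis corona_proj_cases corona_proj_eq_iff range)
  define A where "A = (\<lambda>k\<in>{..<Suc n}. to_multiplier (a k))"
  have A: "A \<in> {..<Suc n} \<rightarrow>\<^sub>E self_adjoint"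
    using a by (auto simp: A_def PiE_iff self_adjoint_def simp flip: to_multiplier_simps)
  have "invertible_elem x" for x :: "'a corona"
    unfolding invertible_elem_def is_unit_elem_def using trivial by blast
  then have "(\<lambda>j\<in>{..<Suc n}. corona_proj (A j)) \<in> Lg (Suc n)"
    using trivial by (auto simp: Lg_def self_adjoint_def)
  then obtain B where B: "B \<in> Lg (Suc n)" "\<And>j. j < Suc n \<Longrightarrow> norm (A j - B j) < \<epsilon>"
    using \<Lambda> A \<epsilon> unfolding property_Lambda_def by blast
  define b where "b k = left_mult (B k) e" for k
  have b: "B k = to_multiplier (b k)" for k unfolding b_def by (rule surj)
  have sa: "b k \<in> self_adjoint" if "k < Suc n" for k
    using B(1) that by (auto simp: Lg_def PiE_iff self_adjoint_def b simp flip: to_multiplier_simps)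
  have "invertible_elem (to_multiplier (\<Sum>k<Suc n. b k * b k))"
    using B(1) by (simp add: Lg_def b to_multiplier_sum to_multiplier_simps)
  then obtain y where "to_multiplier (\<Sum>k<Suc n. b k * b k) * y = to_multiplier e"
    "y * to_multiplier (\<Sum>k<Suc n. b k * b k) = to_multiplier e"
    unfolding invertible_elem_iff \<open>to_multiplier e = 1\<close> by blast
  moreover obtain z where "y = to_multiplier z" using surj by blast
  ultimately have z: "to_multiplier (\<Sum>k<Suc n. b k * b k) * to_multiplier z = to_multiplier e"
    "to_multiplier z * to_multiplier (\<Sum>k<Suc n. b k * b k) = to_multiplier e" by simp_all
  then have "invertible_elem (\<Sum>k<Suc n. b k * b k)"
    unfolding to_multiplier_simps(5)[symmetric] to_multiplier_eq_iff invertible_elem_def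
    using e by (intro exI[of _ z]) (simp del: sum.lessThan_Suc)
  then have "restrict b {..<Suc n} \<in> Lg (Suc n)" using sa by (simp add: Lg_def)
  moreover have "norm (a k - b k) < \<epsilon>" if "k < Suc n" for k
  proof -
    have "norm (to_multiplier (a k - b k)) < \<epsilon>"
      using B(2)[OF that] that by (simp add: A_def b to_multiplier_simps)
    then show ?thesis by simp
  qed
  ultimately show "\<exists>b\<in>Lg (Suc n). \<forall>k<Suc n. norm (a k - b k) < \<epsilon>"
    by (intro bexI[of _ "restrict b {..<Suc n}"]) auto
qed

section \<open>Self-adjoint and invertible elements of the unitization\<close>

lemma self_adjoint_unitization_cases:
  assumes "\<not> unital TYPE('a::cstar_algebra)" "star x = (x :: 'a unitization)"
  obtains p r where "Rep_unitization x = to_multiplier p + r *\<^sub>R 1"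
proof -
  obtain p c where pc: "Rep_unitization x = to_multiplier p + c *\<^sub>C 1"
    using Rep_unitization[of x] by (auto simp: unitization_set_def)
  have "star (Rep_unitization x) = Rep_unitization x"
    using assms(2) by (metis star_unitization.rep_eq)
  then have "to_multiplier (star p) + cnj c *\<^sub>C 1 = to_multiplier p + c *\<^sub>C 1"
    by (simp add: pc star_add star_scaleC to_multiplier_simps)
  \<comment> \<open>For nonunital \<open>A\<close> the decomposition is unique, so the scalar part
    is real.\<close>
  then have "cnj c = c" using injD[OF unitization_inj[OF assms(1)], of "(star p, cnj c)" "(p, c)"] by simp
  then have "c = complex_of_real (Re c)" by (simp add: complex_eq_iff)
  then have "Rep_unitization x = to_multiplier p + Re c *\<^sub>R 1" using pc by (simp add: scaleR_scaleC)
  with that show thesis by blast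
qed

lemma Rep_unitization_sum: "Rep_unitization (sum f I) = (\<Sum>k\<in>I. Rep_unitization (f k))"
  by (induction I rule: infinite_finite_induct) (simp_all add: Rep_unitization_algebra)

text \<open>The equation \<open>y * x = 1\<close> expresses \<open>y\<close> as \<open>1 / r\<close>
  times the difference of 1 and \<open>left_mult y p\<close>. The latter lies in the ideal
  \<open>A\<close>, so the inverse stays in the unitization.\<close>

lemma invertible_in_unitization:
  assumes X: "x = to_multiplier p + r *\<^sub>R 1" "r \<noteq> 0" and inv: "invertible_elem x"
    and x: "x = Rep_unitization z"
  shows "invertible_elem z"
proof -
  obtain y where y: "x * y = 1" "y * x = 1" using inv by (auto simp: invertible_elem_iff)
  have "to_multiplier (left_mult y p) + r *\<^sub>R y = 1"
    using y(2) by (simp add: X(1) distrib_left to_multiplier_ideal)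
  then have "r *\<^sub>R y = 1 - to_multiplier (left_mult y p)" by (simp add: algebra_simps)
  then have "y = inverse r *\<^sub>R (1 - to_multiplier (left_mult y p))"
    using X(2) by (metis real_vector.scale_scale real_vector.scale_one left_inverse)
  moreover have "to_multiplier q \<in> unitization_set" for q :: 'a
    by (rule unitization_setI[of _ q 0]) simp
  ultimately have "y \<in> unitization_set"
    using one_in_unitization_set unitization_set_closed(2,7) by metis
  then obtain w where "y = Rep_unitization w" by (metis Rep_unitization_cases)
  then have "z * w = 1" "w * z = 1"
    using y by (simp_all add: Rep_unitization_inject[symmetric] Rep_unitization_algebra x)
  then show ?thesis by (auto simp: invertible_elem_iff)
qed

lemma Lg_dense_of_property_Lambda_nonunital:
  assumes \<Lambda>: "property_Lambda TYPE('a::cstar_algebra) n" and nonunital: "\<not> unital TYPE('a)"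
  shows "Lg_dense TYPE('a unitization) (Suc n)"
  unfolding Lg_dense_iff
proof (intro ballI allI impI)
  fix a :: "nat \<Rightarrow> 'a unitization" and \<epsilon> :: real
  assume a: "a \<in> {..<Suc n} \<rightarrow>\<^sub>E self_adjoint" and \<epsilon>: "0 < \<epsilon>"
  have "\<exists>p r. Rep_unitization (a k) = to_multiplier p + r *\<^sub>R 1" if "k < Suc n" for k
  proof -
    have "star (a k) = a k" using a that by (auto simp: PiE_iff self_adjoint_def)
    then show ?thesis using self_adjoint_unitization_cases[OF nonunital] by metis
  qed
  then obtain p r where pr: "\<And>k. k < Suc n \<Longrightarrow> Rep_unitization (a k) = to_multiplier (p k) + r k *\<^sub>R 1"
    by metis
  \<comment> \<open>Making every scalar part nonzero costs half of \<open>\<epsilon>\<close>; the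
    other half is left for the property.\<close>
  define s where "s k = (if r k = 0 then \<epsilon> / 2 else r k)" for k
  have s: "s k \<noteq> 0" "\<bar>r k - s k\<bar> \<le> \<epsilon> / 2" for k using \<epsilon> by (auto simp: s_def)
  define A where "A = (\<lambda>k\<in>{..<Suc n}. Rep_unitization (a k) + (s k - r k) *\<^sub>R 1)"
  have Asa: "A \<in> {..<Suc n} \<rightarrow>\<^sub>E self_adjoint"
    using a by (auto simp: A_def PiE_iff self_adjoint_def star_add star_scaleR simp flip: star_unitization.rep_eq)
  have A: "A k = to_multiplier (p k) + s k *\<^sub>R 1" if "k < Suc n" for k
    using pr[OF that] that by (simp add: A_def algebra_simps)
  define \<rho> where "\<rho> = (\<Sum>k<Suc n. s k * s k)"
  have "0 < \<rho>" unfolding \<rho>_def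
    by (rule sum_pos) (use s in \<open>auto simp: zero_less_mult_iff linorder_neq_iff\<close>)
  have proj: "corona_proj (A k) = corona_proj (s k *\<^sub>R 1)" if "k < Suc n" for k
    using A[OF that] by (simp add: corona_proj_eq_iff)
  \<comment> \<open>Stated for any tuple with the same images, since it is applied both to
    \<open>A\<close> and to \<open>b\<close>.\<close>
  have sq: "corona_proj (\<Sum>k<Suc n. c k * c k) = corona_proj (\<rho> *\<^sub>R 1)"
    if "\<And>k. k < Suc n \<Longrightarrow> corona_proj (c k) = corona_proj (A k)" for c
  proof -
    have "corona_proj (\<Sum>k<Suc n. c k * c k) = corona_proj (\<Sum>k<Suc n. (s k *\<^sub>R 1) * (s k *\<^sub>R 1))"
      unfolding corona_proj_sum corona_proj_simps(5)
      by (rule sum.cong) (simp_all add: that proj)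
    also have "(\<Sum>k<Suc n. (s k *\<^sub>R 1) * (s k *\<^sub>R 1)) = \<rho> *\<^sub>R (1 :: 'a multiplier)"
      unfolding \<rho>_def scaleR_sum_left by simp
    finally show ?thesis .
  qed
  have "is_unit_elem (corona_proj (\<rho> *\<^sub>R 1 :: 'a multiplier) * corona_proj (inverse \<rho> *\<^sub>R 1))"
    "is_unit_elem (corona_proj (inverse \<rho> *\<^sub>R 1 :: 'a multiplier) * corona_proj (\<rho> *\<^sub>R 1))"
    using \<open>0 < \<rho>\<close> is_unit_elem_corona_one unfolding corona_proj_simps(5)[symmetric] by simp_all
  then have "invertible_elem (corona_proj (\<rho> *\<^sub>R 1 :: 'a multiplier))"
    unfolding invertible_elem_def by blast
  then have "(\<lambda>j\<in>{..<Suc n}. corona_proj (A j)) \<in> Lg (Suc n)"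
    unfolding Lg_def mem_Collect_eq corona_proj_sum_squares sq[of A, OF refl]
    using Asa by (auto simp: self_adjoint_def PiE_iff simp flip: corona_proj_simps(6))
  then obtain b where b: "b \<in> Lg (Suc n)"
    "\<And>j. j < Suc n \<Longrightarrow> norm (A j - b j) < \<epsilon> / 2 \<and> corona_proj (A j) = corona_proj (b j)"
    using \<Lambda> Asa \<epsilon> half_gt_zero[OF \<epsilon>] unfolding property_Lambda_def by blast
  have "\<exists>z. b k = Rep_unitization z" if k: "k < Suc n" for k
  proof -
    obtain q where "A k - b k = to_multiplier q"
      using b(2)[OF k] by (auto simp: corona_proj_eq_iff)
    then have "b k = to_multiplier (p k - q) + complex_of_real (s k) *\<^sub>C 1"
      using A[OF k] by (simp add: to_multiplier_simps algebra_simps flip: scaleR_scaleC)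
    then have "b k \<in> unitization_set" by (rule unitization_setI)
    then show ?thesis by (metis Rep_unitization_cases)
  qed
  then obtain B where B: "\<And>k. k < Suc n \<Longrightarrow> b k = Rep_unitization (B k)" by metis
  have "B k \<in> self_adjoint" if "k < Suc n" for k
  proof -
    have "star (b k) = b k" using b(1) that by (auto simp: Lg_def PiE_iff self_adjoint_def)
    then have "Rep_unitization (star (B k)) = Rep_unitization (B k)"
      by (simp add: B[OF that] star_unitization.rep_eq)
    then show ?thesis by (simp add: Rep_unitization_inject self_adjoint_def)
  qed
  moreover have "invertible_elem (\<Sum>k<Suc n. B k * B k)"
  proof -
    have "(\<Sum>k<Suc n. b k * b k) - \<rho> *\<^sub>R 1 \<in> range to_multiplier"
      using sq[of b] b(2) by (simp add: corona_proj_eq_iff del: sum.lessThan_Suc)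
    then obtain q where "(\<Sum>k<Suc n. b k * b k) - \<rho> *\<^sub>R 1 = to_multiplier q" by auto
    then have "(\<Sum>k<Suc n. b k * b k) = to_multiplier q + \<rho> *\<^sub>R 1" by (metis diff_add_cancel)
    moreover have "\<rho> \<noteq> 0" using \<open>0 < \<rho>\<close> by simp
    moreover have "invertible_elem (\<Sum>k<Suc n. b k * b k)" using b(1) by (simp add: Lg_def)
    moreover have "(\<Sum>k<Suc n. b k * b k) = Rep_unitization (\<Sum>k<Suc n. B k * B k)"
      unfolding Rep_unitization_sum times_unitization.rep_eq by (rule sum.cong) (simp_all add: B)
    ultimately show ?thesis by (rule invertible_in_unitization)
  qed
  ultimately have "restrict B {..<Suc n} \<in> Lg (Suc n)" by (simp add: Lg_def)
  moreover have "norm (a k - B k) < \<epsilon>" if k: "k < Suc n" for k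
  proof -
    have eq: "Rep_unitization (a k) - b k = (A k - b k) + (r k - s k) *\<^sub>R 1"
      using k by (simp add: A_def algebra_simps)
    have "norm ((r k - s k) *\<^sub>R (1 :: 'a multiplier)) \<le> \<epsilon> / 2 * 1"
      unfolding norm_scaleR using s norm_one_le \<epsilon> by (intro mult_mono) auto
    then have "norm (Rep_unitization (a k) - b k) < \<epsilon>"
      unfolding eq using b(2)[OF k] norm_triangle_ineq[of "A k - b k" "(r k - s k) *\<^sub>R 1"] by linarith
    then show ?thesis by (simp add: Rep_unitization_algebra B[OF k])
  qed
  ultimately show "\<exists>b\<in>Lg (Suc n). \<forall>k<Suc n. norm (a k - b k) < \<epsilon>"
    by (intro bexI[of _ "restrict B {..<Suc n}"]) auto
qed

theorem proposition3p11:
  shows "real_rank TYPE('a::cstar_algebra) \<le> ext_real_rank TYPE('a) \<and>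
    ext_real_rank TYPE('a) \<le> real_rank TYPE('a multiplier)"
proof
  show "real_rank TYPE('a) \<le> ext_real_rank TYPE('a)"
    unfolding real_rank_def ext_real_rank_def real_rank_unital_def
    using Lg_dense_of_property_Lambda_unital[where ?'a = 'a]
      Lg_dense_of_property_Lambda_nonunital[where ?'a = 'a]
    by (auto intro!: Inf_superset_mono)
  have "is_unit_elem (1 :: 'a multiplier)" by (simp add: is_unit_elem_def)
  then have "unital TYPE('a multiplier)" unfolding unital_def by blast
  \<comment> \<open>Density in \<open>M(A)\<close> at length \<open>Suc n\<close> persists for all
    larger lengths and so gives the property for every \<open>m \<ge> n\<close>.\<close>
  then show "ext_real_rank TYPE('a) \<le> real_rank TYPE('a multiplier)"
    unfolding real_rank_def ext_real_rank_def real_rank_unital_def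
    by (auto intro!: Inf_superset_mono property_Lambda_of_Lg_dense intro: Lg_dense_mono)
qed

end
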